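(* Let $\mathcal{C}$ be a class of topological semigroups such that $\mathsf{T}_{\mathsf z}\mathsf{S}\subseteq\mathcal{C}\subseteq\mathsf{T}_1\mathsf{S}$. The center $Z(X)$ of an injectively $\mathcal{C}$-closed unipotent semigroup $X$ is injectively $\mathcal{C}$-closed.
   Context: A topological semigroup is a topological space $X$ endowed with a continuous associative binary operation $X\times X\to X$, $(x,y)\mapsto xy$. $\mathsf{T}_1\mathsf{S}$ denotes the class of topological semigroups satisfying the separation axiom $T_1$ (all finite subsets are closed). $\mathsf{T}_{\mathsf z}\mathsf{S}$ denotes the class of Hausdorff zero-dimensional topological semigroups, where a space is zero-dimensional if it has a base of the topology consisting of clopen sets. A topological semigroup $X$ is injectively $\mathcal{C}$-closed if for any injective continuous homomorphism $h:X\to Y$ to a topological semigroup $Y\in\mathcal{C}$ the image $h[X]$ is closed in $Y$. A semigroup $X$ (without topology) is injectively $\mathcal{C}$-closed if $X$ endowed with the discrete topology is injectively $\mathcal{C}$-closed. A semigroup is unipotent if it contains a unique idempotent. The center of a semigroup $X$ is $Z(X)=\{z\in X:\forall x\in X\ (xz=zx)\}$; $X$ is not assumed commutative, and $Z(X)$ may be empty (the empty semigroup is regarded as a semigroup and is injectively $\mathcal{C}$-closed). *)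

theory Defs
  imports "HOL-Analysis.Analysis"
begin

text \<open>
  Semigroups are given by a carrier set and a binary operation on the ambient type, of which only
  the values on the carrier matter. A topological semigroup is a pair of an abstract topology
  \<open>T\<close> (with carrier \<open>topspace T\<close>) and an operation. Empty carriers are allowed.
\<close>

definition semigroup_on :: "'a set \<Rightarrow> ('a \<Rightarrow> 'a \<Rightarrow> 'a) \<Rightarrow> bool" where
  "semigroup_on X mul \<longleftrightarrow>
     (\<forall>x\<in>X. \<forall>y\<in>X. mul x y \<in> X) \<and>
     (\<forall>x\<in>X. \<forall>y\<in>X. \<forall>z\<in>X. mul (mul x y) z = mul x (mul y z))"

definition unipotent_on :: "'a set \<Rightarrow> ('a \<Rightarrow> 'a \<Rightarrow> 'a) \<Rightarrow> bool" where
  "unipotent_on X mul \<longleftrightarrow> (\<exists>!e. e \<in> X \<and> mul e e = e)"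

definition center_on :: "'a set \<Rightarrow> ('a \<Rightarrow> 'a \<Rightarrow> 'a) \<Rightarrow> 'a set" where
  "center_on X mul = {z \<in> X. \<forall>x\<in>X. mul x z = mul z x}"

definition semigroup_hom_on ::
    "'a set \<Rightarrow> ('a \<Rightarrow> 'a \<Rightarrow> 'a) \<Rightarrow> 'b set \<Rightarrow> ('b \<Rightarrow> 'b \<Rightarrow> 'b) \<Rightarrow> ('a \<Rightarrow> 'b) \<Rightarrow> bool" where
  "semigroup_hom_on X mul Y mul' h \<longleftrightarrow>
     h ` X \<subseteq> Y \<and> (\<forall>x\<in>X. \<forall>y\<in>X. h (mul x y) = mul' (h x) (h y))"

definition topological_semigroup :: "'a topology \<Rightarrow> ('a \<Rightarrow> 'a \<Rightarrow> 'a) \<Rightarrow> bool" where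
  "topological_semigroup T mul \<longleftrightarrow>
     semigroup_on (topspace T) mul \<and>
     continuous_map (prod_topology T T) T (\<lambda>(x, y). mul x y)"

definition zero_dimensional_space :: "'a topology \<Rightarrow> bool" where
  "zero_dimensional_space T \<longleftrightarrow>
     (\<exists>\<B>. (\<forall>B\<in>\<B>. openin T B \<and> closedin T B) \<and>
          openin T = arbitrary union_of (\<lambda>B. B \<in> \<B>))"

text \<open>
  HOL has no proper classes, so the ambient type \<open>'a\<close> plays the role of a universe: a class of
  topological semigroups is a set of topological semigroups carried by subsets of \<open>'a\<close>. As \<open>'a\<close>
  is arbitrary, the universe can be taken as large as desired.
\<close>

type_synonym 'a topsgp_class = "('a topology \<times> ('a \<Rightarrow> 'a \<Rightarrow> 'a)) set"

definition T1S :: "'a topsgp_class" where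
  "T1S = {(T, mul). topological_semigroup T mul \<and> t1_space T}"

definition TzS :: "'a topsgp_class" where
  "TzS = {(T, mul). topological_semigroup T mul \<and> Hausdorff_space T \<and> zero_dimensional_space T}"

definition injectively_closed ::
    "'a topsgp_class \<Rightarrow> 'a topology \<Rightarrow> ('a \<Rightarrow> 'a \<Rightarrow> 'a) \<Rightarrow> bool" where
  "injectively_closed \<C> T mul \<longleftrightarrow>
     (\<forall>(S, mul') \<in> \<C>. \<forall>h.
        semigroup_hom_on (topspace T) mul (topspace S) mul' h \<and>
        inj_on h (topspace T) \<and> continuous_map T S h
        \<longrightarrow> closedin S (h ` topspace T))"

definition injectively_closed_semigroup ::
    "'a topsgp_class \<Rightarrow> 'a set \<Rightarrow> ('a \<Rightarrow> 'a \<Rightarrow> 'a) \<Rightarrow> bool" where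
  "injectively_closed_semigroup \<C> X mul \<longleftrightarrow> injectively_closed \<C> (discrete_topology X) mul"

end

theory Submission
  imports Defs "HOL-Algebra.Group"
begin

text \<open>
  Let \<open>Z\<close> be the center, \<open>e\<close> the idempotent of \<open>X\<close>, and assume \<open>Z\<close> infinite. Three properties of
  \<open>Z\<close> follow because their failure allows one to adjoin limit points to \<open>X\<close>, so that \<open>X\<close> becomes
  non-closed in a zero-dimensional Hausdorff semigroup: every \<open>z \<in> Z\<close> has a power equal to \<open>e\<close>
  (otherwise adjoin the limit of \<open>z\<^bsup>n!\<^esup>\<close>); there is no infinite \<open>A \<subseteq> Z\<close> for which \<open>AA\<close> is a
  singleton (otherwise adjoin the limit of \<open>A\<close> along a free ultrafilter); and the group \<open>eZ\<close> is
  finite (otherwise adjoin a point of the Bohr compactification of a countable subgroup). By a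
  combinatorial argument these three properties bound the exponents \<open>n\<close> with \<open>z\<^sup>n \<in> eZ\<close>. Finally,
  if \<open>Z\<close> is mapped injectively into a \<open>T\<^sub>1\<close> semigroup and \<open>y\<close> is a limit point outside the image,
  then, after replacing \<open>y\<close> by one of its powers \<open>y\<^sup>2, y\<^sup>4, \<dots>\<close>, the elements of \<open>Z\<close> near \<open>y\<close> contain
  an infinite set \<open>A\<close> with \<open>AA = {y\<^sup>2}\<close>, a contradiction.
\<close>

section \<open>Adjoining limit points\<close>

text \<open>New points are adjoined to \<open>X\<close>, because only \<open>X\<close> is known to
  be closed; centrality is what lets a limit of central elements be moved past arbitrary elements of
  \<open>X\<close>. As \<open>\<C>\<close> may be as small as \<open>TzS\<close>, each enlarged
  semigroup must be zero-dimensional and Hausdorff, and its carrier must lie in \<open>'a\<close>.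
  Topologies are therefore given by families of sets closed under complement, and points that such a
  family does not separate are identified. The Bohr construction works with a countable subgroup
  because each character then produces only countably many distances, and balls whose radius avoids
  them are clopen. At the other end \<open>\<C>\<close> may reach up to \<open>T1S\<close>, where
  limits are not unique. The closing argument compares limits only for functions with finitely many
  values: there a limit is one of the values and is attained eventually. This is possible because
  \<open>aZ\<close> is finite for every \<open>a \<in> Z\<close>.\<close>

lemma ultrafilter_below:
  assumes "F \<noteq> bot"
  shows "\<exists>U\<le>F. U \<noteq> bot \<and> (\<forall>P. eventually P U \<or> eventually (\<lambda>x. \<not> P x) U)"
proof -
  \<comment> \<open>The order is reversed, so a Zorn-maximal element is a finest proper filter. The
    infimum of a nonempty chain stays proper because each of its eventual properties already holds
    for one member.\<close>
  have "\<exists>m\<in>{G. G \<noteq> bot \<and> G \<le> F}. \<forall>G\<in>{G. G \<noteq> bot \<and> G \<le> F}. G \<le> m \<longrightarrow> G = m"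
  proof (rule predicate_Zorn)
    show "partial_order_on {G. G \<noteq> bot \<and> G \<le> F}
            (relation_of (\<lambda>G H. H \<le> G) {G. G \<noteq> bot \<and> G \<le> F})"
      by (auto simp: partial_order_on_def preorder_on_def refl_on_def trans_def antisym_def relation_of_def)
    fix C
    assume C: "C \<in> Chains (relation_of (\<lambda>G H. H \<le> G) {G. G \<noteq> bot \<and> G \<le> F})"
    show "\<exists>u\<in>{G. G \<noteq> bot \<and> G \<le> F}. \<forall>a\<in>C. u \<le> a"
    proof (cases "C = {}")
      case True
      then show ?thesis using assms by auto
    next
      case False
      have mem: "G \<noteq> bot \<and> G \<le> F" if "G \<in> C" for G
        using that C by (auto simp: Chains_def relation_of_def)
      have "eventually P (Inf C) \<longleftrightarrow> (\<exists>b\<in>C. eventually P b)" for P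
        using False C by (intro eventually_Inf_base) (auto simp: Chains_def relation_of_def)
      then have "Inf C \<noteq> bot"
        using mem by (metis trivial_limit_def)
      moreover have "Inf C \<le> F"
        using False mem by (meson Inf_lower2 ex_in_conv)
      ultimately show ?thesis by (auto intro: Inf_lower)
    qed
  qed
  then obtain U where U: "U \<noteq> bot" "U \<le> F" "\<And>G. G \<noteq> bot \<Longrightarrow> G \<le> U \<Longrightarrow> G = U"
    by (smt (verit) mem_Collect_eq order_trans)
  have "eventually P U \<or> eventually (\<lambda>x. \<not> P x) U" for P
  proof (rule disjCI)
    assume "\<not> eventually (\<lambda>x. \<not> P x) U"
    then have "inf U (principal {x. P x}) \<noteq> bot"
      by (simp add: trivial_limit_def eventually_inf_principal)
    then have "inf U (principal {x. P x}) = U"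
      using U(3) by simp
    moreover have "eventually P (inf U (principal {x. P x}))"
      by (simp add: eventually_inf_principal)
    ultimately show "eventually P U" by simp
  qed
  then show ?thesis using U by blast
qed

text \<open>A zero-dimensional Hausdorff semigroup with a non-closed injective copy of
  \<open>X\<close> contradicts \<open>inj_closed\<close>. Infinity of \<open>X\<close> makes the
  universe \<open>'a\<close> large enough to hold such a copy together with the new points.\<close>

locale injectively_closed_sgrp =
  fixes \<C> :: "'a topsgp_class" and X :: "'a set" and mul :: "'a \<Rightarrow> 'a \<Rightarrow> 'a"
  assumes TzS_subset: "TzS \<subseteq> \<C>"
    and sgrp: "semigroup_on X mul"
    and inj_closed: "injectively_closed_semigroup \<C> X mul"
    and infinite_X: "infinite X"
begin

lemma mul_closed [simp]: "x \<in> X \<Longrightarrow> y \<in> X \<Longrightarrow> mul x y \<in> X"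
  using sgrp by (simp add: semigroup_on_def)

lemma mul_assoc: "x \<in> X \<Longrightarrow> y \<in> X \<Longrightarrow> z \<in> X \<Longrightarrow> mul (mul x y) z = mul x (mul y z)"
  using sgrp by (simp add: semigroup_on_def)

text \<open>
  The points of \<open>P\<close> that no member of \<open>\<S>\<close> separates are identified, and the quotient is copied into
  the universe \<open>'a\<close> along the injection \<open>g\<close>.
\<close>

lemma no_limit_point:
  fixes P :: "'b set" and op :: "'b \<Rightarrow> 'b \<Rightarrow> 'b" and \<S> :: "'b set set" and g :: "'b \<Rightarrow> 'a"
  assumes g: "inj_on g P"
    and P: "semigroup_on P op"
    and sub: "\<And>B. B \<in> \<S> \<Longrightarrow> B \<subseteq> P"
    and compl: "\<And>B. B \<in> \<S> \<Longrightarrow> P - B \<in> \<S>"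
    and cont: "\<And>B p q. \<lbrakk>B \<in> \<S>; p \<in> P; q \<in> P; op p q \<in> B\<rbrakk>
                 \<Longrightarrow> \<exists>U\<in>\<S>. \<exists>V\<in>\<S>. p \<in> U \<and> q \<in> V \<and> (\<forall>u\<in>U. \<forall>v\<in>V. op u v \<in> B)"
    and hom: "semigroup_hom_on X mul P op \<iota>"
    and sep: "\<And>x y. \<lbrakk>x \<in> X; y \<in> X; x \<noteq> y\<rbrakk> \<Longrightarrow> \<exists>B\<in>\<S>. \<iota> x \<in> B \<and> \<iota> y \<notin> B"
    and q: "q \<in> P"
    and sep_q: "\<And>x. x \<in> X \<Longrightarrow> \<exists>B\<in>\<S>. q \<in> B \<and> \<iota> x \<notin> B"
    and limit: "\<And>\<F>. \<lbrakk>finite \<F>; \<F> \<subseteq> \<S>; \<And>B. B \<in> \<F> \<Longrightarrow> q \<in> B\<rbrakk> \<Longrightarrow> \<exists>x\<in>X. \<forall>B\<in>\<F>. \<iota> x \<in> B"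
  shows False
proof -
  define eqv where "eqv p p' \<longleftrightarrow> p \<in> P \<and> p' \<in> P \<and> (\<forall>B\<in>\<S>. p \<in> B \<longleftrightarrow> p' \<in> B)" for p p'
  \<comment> \<open>\<open>rep p\<close> depends only on the predicate \<open>eqv p\<close>, so
    equivalent points receive literally the same representative, and \<open>\<gamma>\<close> is the
    quotient map followed by \<open>g\<close>.\<close>
  define rep where "rep p = (SOME p'. eqv p p')" for p
  define \<gamma> where "\<gamma> p = g (rep p)" for p
  have rep: "eqv p (rep p)" if "p \<in> P" for p
    unfolding rep_def by (rule someI[of _ p]) (use that in \<open>simp add: eqv_def\<close>)
  then have rep_P: "rep p \<in> P" if "p \<in> P" for p
    using that by (simp add: eqv_def)
  have \<gamma>_eq: "\<gamma> p = \<gamma> p' \<longleftrightarrow> eqv p p'" if p: "p \<in> P" "p' \<in> P" for p p'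
  proof
    assume "\<gamma> p = \<gamma> p'"
    then have "rep p = rep p'"
      using g rep_P p by (simp add: \<gamma>_def inj_on_eq_iff)
    then have "eqv p (rep p')" "eqv p' (rep p')"
      using rep p by metis+
    then show "eqv p p'"
      unfolding eqv_def by blast
  next
    assume "eqv p p'"
    then have "eqv p r \<longleftrightarrow> eqv p' r" for r unfolding eqv_def by blast
    then show "\<gamma> p = \<gamma> p'" by (simp add: \<gamma>_def rep_def)
  qed
  have \<gamma>_mem: "\<gamma> p \<in> \<gamma> ` B \<longleftrightarrow> p \<in> B" if "B \<in> \<S>" "p \<in> P" for p B
  proof
    assume "\<gamma> p \<in> \<gamma> ` B"
    then obtain p' where "p' \<in> B" "\<gamma> p = \<gamma> p'" by auto
    moreover have "p' \<in> P" using sub[OF that(1)] \<open>p' \<in> B\<close> by blast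
    ultimately show "p \<in> B" using \<gamma>_eq[OF that(2)] that(1) unfolding eqv_def by blast
  qed simp
  define \<delta> where "\<delta> = inv_into P \<gamma>"
  have \<delta>: "\<delta> y \<in> P" "\<gamma> (\<delta> y) = y" if "y \<in> \<gamma> ` P" for y
    using that by (auto simp: \<delta>_def inv_into_into f_inv_into_f)
  define op' where "op' y z = \<gamma> (op (\<delta> y) (\<delta> z))" for y z
  have op_closed: "op p r \<in> P" if "p \<in> P" "r \<in> P" for p r
    using P that by (simp add: semigroup_on_def)
  \<comment> \<open>Members of \<open>\<S>\<close> do not distinguish equivalent points, so the
    rectangle that \<open>cont\<close> supplies around \<open>(p, r)\<close> also contains
    \<open>(p', r')\<close>. Thus continuity alone makes \<open>eqv\<close> a congruence.\<close>
  have cong: "\<gamma> (op p r) = \<gamma> (op p' r')" if "\<gamma> p = \<gamma> p'" "\<gamma> r = \<gamma> r'" "p \<in> P" "p' \<in> P" "r \<in> P" "r' \<in> P"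
    for p p' r r'
  proof -
    have "op p' r' \<in> B" if B: "B \<in> \<S>" "op p r \<in> B" and e: "eqv p p'" "eqv r r'" for B p p' r r'
    proof -
      have "p \<in> P" "r \<in> P" using e by (auto simp: eqv_def)
      from cont[OF B(1) this B(2)] obtain U V where UV: "U \<in> \<S>" "V \<in> \<S>" "p \<in> U" "r \<in> V"
        and prod: "\<And>u v. u \<in> U \<Longrightarrow> v \<in> V \<Longrightarrow> op u v \<in> B"
        by metis
      then have "p' \<in> U" "r' \<in> V" using e by (auto simp: eqv_def)
      then show ?thesis by (rule prod)
    qed
    moreover have "eqv p p'" "eqv r r'" "eqv p' p" "eqv r' r"
      using that \<gamma>_eq by metis+
    ultimately have "op p r \<in> B \<longleftrightarrow> op p' r' \<in> B" if "B \<in> \<S>" for B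
      using that by metis
    then have "eqv (op p r) (op p' r')"
      using op_closed that by (simp add: eqv_def)
    then show ?thesis
      using op_closed that by (simp add: \<gamma>_eq)
  qed
  have op': "op' (\<gamma> p) (\<gamma> r) = \<gamma> (op p r)" if "p \<in> P" "r \<in> P" for p r
    unfolding op'_def using that by (intro cong \<delta> imageI)
  define T where "T = topology_generated_by ((`) \<gamma> ` \<S>)"
  have "X \<noteq> {}" using infinite_X by (metis finite.emptyI)
  then obtain x0 where "x0 \<in> X" by (metis ex_in_conv)
  from sep_q[OF this] obtain B0 where B0: "B0 \<in> \<S>" by metis
  have topT: "topspace T = \<gamma> ` P"
  proof -
    have "\<Union>\<S> = P"
      using sub[OF B0] compl[OF B0] sub B0 by blast
    then show ?thesis
      unfolding T_def topology_generated_by_topspace by (simp flip: image_Union)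
  qed
  have open_B: "openin T (\<gamma> ` B)" if "B \<in> \<S>" for B
    unfolding T_def by (rule topology_generated_by_Basis) (use that in blast)
  have compl_img: "topspace T - \<gamma> ` B = \<gamma> ` (P - B)" if "B \<in> \<S>" for B
    unfolding topT using \<gamma>_mem[OF that] by auto
  have closed_B: "closedin T (\<gamma> ` B)" if "B \<in> \<S>" for B
    unfolding closedin_def compl_img[OF that]
    using open_B[OF compl[OF that]] sub[OF that] by (auto simp: topT)
  have sg: "semigroup_on (topspace T) op'"
    unfolding topT semigroup_on_def using P by (auto simp: op' op_closed semigroup_on_def)
  have "continuous_map (prod_topology T T) T (\<lambda>(y, z). op' y z)"
    unfolding T_def
  proof (rule continuous_on_generated_topo)
    fix W assume "W \<in> (`) \<gamma> ` \<S>"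
    then obtain B where B: "B \<in> \<S>" "W = \<gamma> ` B" by auto
    show "openin (prod_topology (topology_generated_by ((`) \<gamma> ` \<S>)) (topology_generated_by ((`) \<gamma> ` \<S>)))
            ((\<lambda>(y, z). op' y z) -` W \<inter> topspace (prod_topology (topology_generated_by ((`) \<gamma> ` \<S>))
               (topology_generated_by ((`) \<gamma> ` \<S>))))"
      unfolding T_def[symmetric]
    proof (subst openin_subopen, intro ballI)
      fix w assume "w \<in> (\<lambda>(y, z). op' y z) -` W \<inter> topspace (prod_topology T T)"
      then obtain p r where w: "w = (\<gamma> p, \<gamma> r)" "p \<in> P" "r \<in> P" "\<gamma> (op p r) \<in> \<gamma> ` B"
        by (auto simp: topT B op')
      then have "op p r \<in> B" using \<gamma>_mem[OF B(1) op_closed] by metis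
      then obtain U V where UV: "U \<in> \<S>" "V \<in> \<S>" "p \<in> U" "r \<in> V" "\<forall>u\<in>U. \<forall>v\<in>V. op u v \<in> B"
        using cont[OF B(1) w(2,3)] by metis
      show "\<exists>Ta. openin (prod_topology T T) Ta \<and> w \<in> Ta \<and>
              Ta \<subseteq> (\<lambda>(y, z). op' y z) -` W \<inter> topspace (prod_topology T T)"
      proof (intro exI conjI)
        show "openin (prod_topology T T) (\<gamma> ` U \<times> \<gamma> ` V)"
          using UV by (simp add: openin_prod_Times_iff open_B)
        show "w \<in> \<gamma> ` U \<times> \<gamma> ` V" using w UV by auto
        show "\<gamma> ` U \<times> \<gamma> ` V \<subseteq> (\<lambda>(y, z). op' y z) -` W \<inter> topspace (prod_topology T T)"
          using UV sub[OF UV(1)] sub[OF UV(2)] by (auto simp: topT B op' subset_iff)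
      qed
    qed
  next
    show "(\<lambda>(y, z). op' y z) ` topspace (prod_topology (topology_generated_by ((`) \<gamma> ` \<S>))
            (topology_generated_by ((`) \<gamma> ` \<S>))) \<subseteq> \<Union> ((`) \<gamma> ` \<S>)"
      unfolding T_def[symmetric] topology_generated_by_topspace[symmetric]
      using sg by (auto simp: semigroup_on_def)
  qed
  then have ts: "topological_semigroup T op'"
    using sg by (simp add: topological_semigroup_def)
  have "Hausdorff_space T"
    unfolding Hausdorff_space_def topT
  proof (intro allI impI, elim conjE imageE)
    fix y z p r assume a: "y \<noteq> z" "y = \<gamma> p" "z = \<gamma> r" "p \<in> P" "r \<in> P"
    then obtain B where B: "B \<in> \<S>" "p \<in> B \<longleftrightarrow> r \<notin> B" using \<gamma>_eq[of p r] unfolding eqv_def by metis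
    have "disjnt (\<gamma> ` B) (\<gamma> ` (P - B))" "disjnt (\<gamma> ` (P - B)) (\<gamma> ` B)"
      using compl_img[OF B(1)] by (auto simp: disjnt_iff)
    then show "\<exists>U V. openin T U \<and> openin T V \<and> y \<in> U \<and> z \<in> V \<and> disjnt U V"
      using a B open_B[OF B(1)] open_B[OF compl[OF B(1)]] by (metis DiffI image_eqI)
  qed
  moreover have "zero_dimensional_space T"
    unfolding zero_dimensional_space_def
  proof (intro exI conjI)
    \<comment> \<open>All clopen sets serve as the base. The generating sets are clopen by
      \<open>compl\<close>, and the induction carries clopen neighbourhoods of points through
      intersections and unions.\<close>
    let ?\<B> = "{B. openin T B \<and> closedin T B}"
    show "\<forall>B\<in>?\<B>. openin T B \<and> closedin T B" by simp
    have "(arbitrary union_of (\<lambda>B. B \<in> ?\<B>)) U" if "generate_topology_on ((`) \<gamma> ` \<S>) U" for U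
    proof -
      have "\<forall>x\<in>U. \<exists>K. openin T K \<and> closedin T K \<and> x \<in> K \<and> K \<subseteq> U"
        using that
      proof induction
        case (Int a b)
        show ?case
        proof
          fix x assume "x \<in> a \<inter> b"
          then obtain K L where "openin T K" "closedin T K" "x \<in> K" "K \<subseteq> a"
            "openin T L" "closedin T L" "x \<in> L" "L \<subseteq> b" using Int by (meson IntD1 IntD2)
          then show "\<exists>K. openin T K \<and> closedin T K \<and> x \<in> K \<and> K \<subseteq> a \<inter> b"
            by (intro exI[of _ "K \<inter> L"]) (auto intro: openin_Int closedin_Int)
        qed
      next
        case (UN K)
        then show ?case by (meson Union_iff Union_upper subset_trans)
      qed (use open_B closed_B in auto)
      then have "U = \<Union>{K. openin T K \<and> closedin T K \<and> K \<subseteq> U}" by blast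
      moreover have "(arbitrary union_of (\<lambda>B. B \<in> ?\<B>)) (\<Union>{K. openin T K \<and> closedin T K \<and> K \<subseteq> U})"
        by (rule arbitrary_union_of_Union) (auto intro: arbitrary_union_of_inc)
      ultimately show ?thesis by simp
    qed
    moreover have "openin T U" if "(arbitrary union_of (\<lambda>B. B \<in> ?\<B>)) U" for U
      using that by (auto simp: union_of_def arbitrary_def)
    moreover have "openin T U \<longleftrightarrow> generate_topology_on ((`) \<gamma> ` \<S>) U" for U
      by (simp add: T_def openin_topology_generated_by_iff)
    ultimately show "openin T = arbitrary union_of (\<lambda>B. B \<in> ?\<B>)"
      by (intro ext) metis
  qed
  ultimately have "(T, op') \<in> \<C>"
    using TzS_subset ts by (auto simp: TzS_def)
  moreover have "semigroup_hom_on X mul (topspace T) op' (\<gamma> \<circ> \<iota>)"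
    using hom by (auto simp: semigroup_hom_on_def topT op' image_subset_iff)
  moreover have "inj_on (\<gamma> \<circ> \<iota>) X"
  proof (rule inj_onI, rule ccontr)
    fix x y assume a: "x \<in> X" "y \<in> X" "(\<gamma> \<circ> \<iota>) x = (\<gamma> \<circ> \<iota>) y" "x \<noteq> y"
    then have "eqv (\<iota> x) (\<iota> y)"
      using hom \<gamma>_eq by (simp add: semigroup_hom_on_def image_subset_iff)
    then show False using sep[OF a(1,2,4)] unfolding eqv_def by metis
  qed
  moreover have "continuous_map (discrete_topology X) T (\<gamma> \<circ> \<iota>)"
    using hom by (auto simp: semigroup_hom_on_def topT)
  ultimately have cl: "closedin T ((\<gamma> \<circ> \<iota>) ` X)"
    using inj_closed unfolding injectively_closed_semigroup_def injectively_closed_def topspace_discrete_topology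
    by blast
  \<comment> \<open>Every open set around \<open>\<gamma> q\<close> contains the image of a finite
    intersection of members of \<open>\<S>\<close> around \<open>q\<close>. Applied to the
    complement of the image of \<open>X\<close>, this contradicts \<open>limit\<close>.\<close>
  have "\<exists>\<F>. finite \<F> \<and> \<F> \<subseteq> \<S> \<and> (\<forall>B\<in>\<F>. q \<in> B) \<and> (\<forall>p\<in>P. (\<forall>B\<in>\<F>. p \<in> B) \<longrightarrow> \<gamma> p \<in> U)"
    if "generate_topology_on ((`) \<gamma> ` \<S>) U" "\<gamma> q \<in> U" for U
    using that
  proof induction
    case (Int a b)
    from Int.prems have "\<gamma> q \<in> a" "\<gamma> q \<in> b" by auto
    from Int.IH(1)[OF this(1)] Int.IH(2)[OF this(2)] obtain \<F> \<G>
      where "finite \<F> \<and> \<F> \<subseteq> \<S> \<and> (\<forall>B\<in>\<F>. q \<in> B) \<and> (\<forall>p\<in>P. (\<forall>B\<in>\<F>. p \<in> B) \<longrightarrow> \<gamma> p \<in> a)"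
        "finite \<G> \<and> \<G> \<subseteq> \<S> \<and> (\<forall>B\<in>\<G>. q \<in> B) \<and> (\<forall>p\<in>P. (\<forall>B\<in>\<G>. p \<in> B) \<longrightarrow> \<gamma> p \<in> b)"
      by (elim exE)
    then show ?case by (intro exI[of _ "\<F> \<union> \<G>"]) (simp add: ball_Un)
  next
    case (UN K)
    from UN.prems obtain k where k: "k \<in> K" "\<gamma> q \<in> k" by auto
    from UN.IH[OF this] show ?case using k(1) by (elim exE) (meson UnionI)
  next
    case (Basis s)
    then obtain B where "B \<in> \<S>" "s = \<gamma> ` B" by auto
    then show ?case using Basis.prems \<gamma>_mem[OF \<open>B \<in> \<S>\<close> q] by (intro exI[of _ "{B}"]) simp
  qed simp
  moreover have "openin T (topspace T - (\<gamma> \<circ> \<iota>) ` X)"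
    using cl by (simp add: closedin_def)
  then have "generate_topology_on ((`) \<gamma> ` \<S>) (topspace T - (\<gamma> \<circ> \<iota>) ` X)"
    by (simp add: T_def openin_topology_generated_by_iff)
  moreover have "\<gamma> q \<in> topspace T - (\<gamma> \<circ> \<iota>) ` X"
  proof -
    have "\<gamma> q \<noteq> \<gamma> (\<iota> x)" if x: "x \<in> X" for x
    proof -
      have "\<iota> x \<in> P" using x hom by (auto simp: semigroup_hom_on_def)
      then show ?thesis using sep_q[OF x] \<gamma>_eq[OF q] unfolding eqv_def by metis
    qed
    then show ?thesis using q by (auto simp: topT)
  qed
  ultimately obtain \<F> where F: "finite \<F>" "\<F> \<subseteq> \<S>" "\<forall>B\<in>\<F>. q \<in> B"
    "\<forall>p\<in>P. (\<forall>B\<in>\<F>. p \<in> B) \<longrightarrow> \<gamma> p \<in> topspace T - (\<gamma> \<circ> \<iota>) ` X"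
    by metis
  then obtain x where "x \<in> X" "\<forall>B\<in>\<F>. \<iota> x \<in> B" using limit[OF F(1,2)] by metis
  moreover then have "\<iota> x \<in> P" using hom by (simp add: semigroup_hom_on_def image_subset_iff)
  ultimately show False using F(4) by auto
qed

end

text \<open>For infinite \<open>'a\<close> the square \<open>'a \<times> 'a\<close> embeds into
  \<open>'a\<close>, and so does \<open>nat\<close>. The injection codes the old points and
  countably many new copies of them inside \<open>'a\<close>.\<close>

lemma inj_prod_nat:
  assumes "infinite (UNIV :: 'a set)"
  shows "\<exists>g :: 'a \<times> nat \<Rightarrow> 'a. inj g"
proof -
  obtain f :: "'a \<times> 'a \<Rightarrow> 'a" where "inj f"
    using card_of_Times_same_infinite[OF assms] by (auto simp: card_of_ordIso[symmetric] bij_betw_def)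
  moreover obtain n :: "nat \<Rightarrow> 'a" where "inj n"
    using infinite_countable_subset[OF assms] by auto
  ultimately have "inj (\<lambda>(x, i). f (x, n i))"
    by (intro injI) (simp add: inj_eq split_beta prod_eq_iff)
  then show ?thesis by blast
qed

section \<open>Limits of iterates along multiples of factorials\<close>

context injectively_closed_sgrp
begin

lemma infinite_UNIV: "infinite (UNIV :: 'a set)"
  using infinite_X by (rule infinite_super[rotated]) simp

text \<open>
  The limit point adjoined here is \<open>lim T\<^sup>k\<close> along the multiples \<open>k\<close> of \<open>n!\<close> as \<open>n \<rightarrow> \<infinity>\<close>: on a
  finite orbit this limit exists already in \<open>X\<close>.
\<close>

lemma finite_orbit:
  assumes T: "\<And>x. x \<in> X \<Longrightarrow> T x \<in> X"
    and T_left: "\<And>x y. \<lbrakk>x \<in> X; y \<in> X\<rbrakk> \<Longrightarrow> T (mul x y) = mul (T x) y"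
    and T_right: "\<And>x y. \<lbrakk>x \<in> X; y \<in> X\<rbrakk> \<Longrightarrow> T (mul x y) = mul x (T y)"
    and x0: "x0 \<in> X"
  shows "\<exists>i j. i < j \<and> (T ^^ i) x0 = (T ^^ j) x0"
proof (rule ccontr)
  assume no_repeat: "\<not> (\<exists>i j. i < j \<and> (T ^^ i) x0 = (T ^^ j) x0)"
  \<comment> \<open>The filter generated by the sets of positive multiples of \<open>n!\<close>.
    These sets are closed under addition, so the limit of \<open>T^k\<close> along it behaves as an
    idempotent operator; this is why the flags in \<open>op\<close> below combine by
    disjunction.\<close>
  define ev where "ev Q \<longleftrightarrow> (\<exists>n. \<forall>k>0. fact n dvd k \<longrightarrow> Q k)" for Q :: "nat \<Rightarrow> bool"
  have ev_conj: "ev (\<lambda>k. Q k \<and> R k)" if QR: "ev Q" "ev R" for Q R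
  proof -
    obtain n m where "\<forall>k>0. fact n dvd k \<longrightarrow> Q k" "\<forall>k>0. fact m dvd k \<longrightarrow> R k"
      using QR by (auto simp: ev_def)
    moreover have "(fact n :: nat) dvd fact (max n m)" "(fact m :: nat) dvd fact (max n m)"
      by (simp_all add: fact_dvd)
    ultimately show ?thesis unfolding ev_def by (meson dvd_trans)
  qed
  have ev_mono: "ev R" if "ev Q" "\<And>k. Q k \<Longrightarrow> R k" for Q R
    using that unfolding ev_def by blast
  have ev_ex: "\<exists>k>0. Q k" if "ev Q" for Q
    using that unfolding ev_def by (meson dvd_refl fact_gt_zero)
  have ev_double: "ev (\<lambda>k. Q (2 * k))" if "ev Q" for Q
    using that unfolding ev_def by (metis dvd_mult mult_pos_pos zero_less_numeral)
  have ev_not: "\<not> (ev Q \<and> ev (\<lambda>k. \<not> Q k))" for Q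
    using ev_conj[of Q "\<lambda>k. \<not> Q k"] ev_ex by auto
  have ev_large: "ev (\<lambda>k. k > n)" for n
    unfolding ev_def
  proof (intro exI allI impI)
    fix k :: nat assume "k > 0" "fact (Suc n) dvd k"
    then show "k > n"
      by (meson Suc_le_eq dvd_imp_le fact_ge_self order_trans)
  qed
  have Tk: "(T ^^ k) x \<in> X" if "x \<in> X" for k x
    using that T by (induction k) auto
  have Tk_left: "(T ^^ k) (mul x y) = mul ((T ^^ k) x) y" if "x \<in> X" "y \<in> X" for k x y
    using that Tk T_left by (induction k) auto
  have Tk_right: "(T ^^ k) (mul x y) = mul x ((T ^^ k) y)" if "x \<in> X" "y \<in> X" for k x y
    using that Tk T_right by (induction k) auto
  have Tk_prod: "mul ((T ^^ k) x) ((T ^^ l) y) = (T ^^ (k + l)) (mul x y)" if "x \<in> X" "y \<in> X" for k l x y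
  proof -
    have "(T ^^ (k + l)) (mul x y) = (T ^^ k) (mul x ((T ^^ l) y))"
      using that by (simp add: funpow_add Tk_right)
    then show ?thesis using that Tk by (simp add: Tk_left)
  qed
  \<comment> \<open>\<open>ev\<close> is not an ultrafilter, so only sets that it decides on every
    orbit can serve as clopen sets. \<open>star\<close> extends such a set to the points
    \<open>(x, True)\<close>, which stand for the limit of \<open>T^k x\<close>.\<close>
  define dec where "dec B \<longleftrightarrow> B \<subseteq> X \<and>
    (\<forall>x\<in>X. ev (\<lambda>k. (T ^^ k) x \<in> B) \<or> ev (\<lambda>k. (T ^^ k) x \<notin> B))" for B
  define star where "star B = {(x, b). x \<in> X \<and> (if b then ev (\<lambda>k. (T ^^ k) x \<in> B) else x \<in> B)}" for B
  define op where "op = (\<lambda>(x, b) (y, c). (mul x y, b \<or> c))"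
  have inj_or_const: "(\<forall>i j. (T ^^ i) w = (T ^^ j) w \<longrightarrow> i = j) \<or> (\<exists>v. ev (\<lambda>k. (T ^^ k) w = v))"
    for w
  proof (rule disjCI)
    assume "\<not> (\<exists>v. ev (\<lambda>k. (T ^^ k) w = v))"
    show "\<forall>i j. (T ^^ i) w = (T ^^ j) w \<longrightarrow> i = j"
    proof (rule ccontr)
      assume "\<not> (\<forall>i j. (T ^^ i) w = (T ^^ j) w \<longrightarrow> i = j)"
      then obtain i j where ij: "i < j" "(T ^^ i) w = (T ^^ j) w"
        by (metis nat_neq_iff)
      obtain p where "p > 0" and j: "i + p = j"
        using ij(1) less_imp_add_positive by metis
      have ip: "(T ^^ (i + p)) w = (T ^^ i) w"
        unfolding j by (rule ij(2)[symmetric])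
      have step: "(T ^^ (l + p)) w = (T ^^ l) w" if "l \<ge> i" for l
      proof -
        have "l + p = (l - i) + (i + p)" using that by simp
        then have "(T ^^ (l + p)) w = (T ^^ (l - i)) ((T ^^ (i + p)) w)"
          by (simp only: funpow_add comp_apply)
        also have "\<dots> = (T ^^ ((l - i) + i)) w"
          unfolding ip by (simp only: funpow_add comp_apply)
        finally show ?thesis using that by simp
      qed
      have steps: "(T ^^ (l + p * d)) w = (T ^^ l) w" if "l \<ge> i" for l d
      proof (induction d)
        case (Suc d)
        have "(T ^^ (l + p * Suc d)) w = (T ^^ ((l + p * d) + p)) w"
          by (simp add: algebra_simps)
        then show ?case using Suc step[of "l + p * d"] that by simp
      qed simp
      \<comment> \<open>\<open>(i + p)!\<close> is divisible by the period \<open>p\<close> and at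
        least as large as the preperiod \<open>i\<close>, so all its positive multiples give the
        same iterate.\<close>
      define k0 where "k0 = (fact (i + p) :: nat)"
      have "p dvd k0" unfolding k0_def using \<open>p > 0\<close> by (intro dvd_fact) auto
      have "i \<le> k0" unfolding k0_def by (meson fact_ge_self le_add1 order_trans)
      have "(T ^^ k) w = (T ^^ k0) w" if k: "k > 0" "k0 dvd k" for k
      proof -
        have "k0 \<le> k" using k by (simp add: dvd_imp_le)
        moreover have "p dvd k - k0"
          using \<open>p dvd k0\<close> k by (meson dvd_diff_nat dvd_trans)
        ultimately obtain d where "k = k0 + p * d"
          by (metis dvdE le_add_diff_inverse)
        then show ?thesis using steps \<open>i \<le> k0\<close> by simp
      qed
      then have "ev (\<lambda>k. (T ^^ k) w = (T ^^ k0) w)"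
        unfolding ev_def k0_def by blast
      then show False using \<open>\<not> (\<exists>v. ev (\<lambda>k. (T ^^ k) w = v))\<close> by blast
    qed
  qed
  have const_dec: "ev (\<lambda>k. (T ^^ k) w \<in> B) \<or> ev (\<lambda>k. (T ^^ k) w \<notin> B)" if "ev (\<lambda>k. (T ^^ k) w = v)" for v w B
    using ev_mono[OF that, of "\<lambda>k. (T ^^ k) w \<in> B"] ev_mono[OF that, of "\<lambda>k. (T ^^ k) w \<notin> B"]
    by (cases "v \<in> B") simp_all
  have dec_singleton: "dec {v}" if "v \<in> X" for v
    unfolding dec_def
  proof (intro conjI ballI)
    fix w assume "w \<in> X"
    show "ev (\<lambda>k. (T ^^ k) w \<in> {v}) \<or> ev (\<lambda>k. (T ^^ k) w \<notin> {v})"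
    proof (cases "\<exists>u. ev (\<lambda>k. (T ^^ k) w = u)")
      case True
      then show ?thesis using const_dec by blast
    next
      case False
      then have inj: "i = j" if "(T ^^ i) w = (T ^^ j) w" for i j using inj_or_const that by blast
      show ?thesis
      proof (cases "\<exists>k0. (T ^^ k0) w = v")
        case True
        then obtain k0 where "(T ^^ k0) w = v" by blast
        then show ?thesis using ev_mono[OF ev_large[of k0], of "\<lambda>k. (T ^^ k) w \<notin> {v}"] inj by auto
      next
        case False
        then show ?thesis using ev_mono[OF ev_large[of 0], of "\<lambda>k. (T ^^ k) w \<notin> {v}"] by auto
      qed
    qed
  qed (use that in auto)
  \<comment> \<open>The sets \<open>star (tail n x)\<close> serve as neighbourhoods of
    \<open>(x, True)\<close>. If two orbits merge, \<open>T^k w = T^l x\<close>, then for large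
    multiples \<open>m\<close> of \<open>n!\<close> membership of \<open>T^m w\<close> in the tail
    means that \<open>n!\<close> divides \<open>l - k\<close>, independently of \<open>m\<close>. As
    \<open>l - k\<close> may be negative, the argument passes to integers.\<close>
  define tail where "tail n x = {(T ^^ k) x | k. k > 0 \<and> fact n dvd k}" for n x
  have dec_tail: "dec (tail n x)" if x: "x \<in> X" for n x
    unfolding dec_def
  proof (intro conjI ballI)
    fix w assume w: "w \<in> X"
    show "ev (\<lambda>k. (T ^^ k) w \<in> tail n x) \<or> ev (\<lambda>k. (T ^^ k) w \<notin> tail n x)"
    proof (cases "\<exists>u. ev (\<lambda>k. (T ^^ k) w = u)")
      case True
      then show ?thesis using const_dec by blast
    next
      case False
      then have inj: "i = j" if "(T ^^ i) w = (T ^^ j) w" for i j using inj_or_const that by blast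
      show ?thesis
      proof (cases "\<exists>k l. (T ^^ k) w = (T ^^ l) x")
        case True
        then obtain k l where kl: "(T ^^ k) w = (T ^^ l) x" by blast
        have shift: "(T ^^ (k + d)) w = (T ^^ (l + d)) x" for d
          using kl by (metis add.commute comp_apply funpow_add)
        have injx: "i = j" if "(T ^^ i) x = (T ^^ j) x" for i j
        proof -
          have "(T ^^ (l + i)) x = (T ^^ (l + j)) x"
            using that by (metis comp_apply funpow_add)
          then have "(T ^^ (k + i)) w = (T ^^ (k + j)) w" using shift by simp
          then show ?thesis using inj by force
        qed
        have iff: "(T ^^ (k + d)) w \<in> tail n x \<longleftrightarrow> l + d > 0 \<and> fact n dvd l + d" for d
          unfolding shift tail_def using injx by auto
        have ev_n: "ev (\<lambda>m. fact n dvd m \<and> m > k)"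
          by (rule ev_conj[OF _ ev_large]) (auto simp: ev_def)
        have *: "(T ^^ m) w \<in> tail n x \<longleftrightarrow> int (fact n) dvd int l - int k"
          if m: "fact n dvd m \<and> m > k" for m
        proof -
          obtain d where d: "m = k + d" "d > 0" using m less_imp_add_positive by metis
          have "int (fact n) dvd int k + int d"
            using m d by (metis int_dvd_int_iff of_nat_add)
          moreover have "int l + int d = (int l - int k) + (int k + int d)" by simp
          ultimately have "int (fact n) dvd int l + int d \<longleftrightarrow> int (fact n) dvd int l - int k"
            by (metis dvd_add_left_iff)
          then show ?thesis
            using d iff[of d] by (metis add_gr_0 int_dvd_int_iff of_nat_add)
        qed
        then show ?thesis
          using ev_mono[OF ev_n, of "\<lambda>m. (T ^^ m) w \<in> tail n x"]
            ev_mono[OF ev_n, of "\<lambda>m. (T ^^ m) w \<notin> tail n x"] by blast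
      next
        case False
        then have "(T ^^ k) w \<notin> tail n x" for k by (auto simp: tail_def)
        then show ?thesis using ev_mono[OF ev_large[of 0], of "\<lambda>k. (T ^^ k) w \<notin> tail n x"] by auto
      qed
    qed
  qed (use x Tk in \<open>auto simp: tail_def\<close>)
  have star_prod: "op u v \<in> star B"
    if B: "dec B" and C: "C \<subseteq> X" and D: "D \<subseteq> X" and CD: "\<And>c d. \<lbrakk>c \<in> C; d \<in> D\<rbrakk> \<Longrightarrow> mul c d \<in> B"
      and u: "u \<in> star C" and v: "v \<in> star D" for B C D u v
  proof -
    obtain x b y c where uv: "u = (x, b)" "v = (y, c)" by (cases u, cases v)
    have x: "x \<in> X" and y: "y \<in> X" using u v by (auto simp: star_def uv)
    have eC: "ev (\<lambda>k. (T ^^ k) x \<in> C)" if b using u that by (simp add: star_def uv)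
    have eD: "ev (\<lambda>k. (T ^^ k) y \<in> D)" if c using v that by (simp add: star_def uv)
    have xC: "x \<in> C" if "\<not> b" using u that by (simp add: star_def uv)
    have yD: "y \<in> D" if "\<not> c" using v that by (simp add: star_def uv)
    have "ev (\<lambda>k. (T ^^ k) (mul x y) \<in> B)" if "b \<or> c"
    proof (cases "b \<and> c")
      case True
      then have "ev (\<lambda>k. (T ^^ k) x \<in> C \<and> (T ^^ k) y \<in> D)" using eC eD ev_conj by blast
      then have *: "ev (\<lambda>k. (T ^^ (2 * k)) (mul x y) \<in> B)"
        by (rule ev_mono) (metis CD Tk_prod mult_2 x y)
      \<comment> \<open>Only even exponents are known to lead into \<open>B\<close>. Since
        \<open>B\<close> is decided, the alternative is eventual avoidance, which would include the
        even exponents.\<close>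
      show ?thesis
      proof (rule ccontr)
        assume "\<not> ?thesis"
        then have "ev (\<lambda>k. (T ^^ k) (mul x y) \<notin> B)"
          using B x y by (auto simp: dec_def)
        from ev_double[OF this] * ev_not show False by blast
      qed
    next
      case False
      with that consider "b" "\<not> c" | "\<not> b" "c" by blast
      then show ?thesis
      proof cases
        case 1
        show ?thesis
          by (rule ev_mono[OF eC[OF 1(1)]]) (use CD yD 1 Tk_left x y in simp)
      next
        case 2
        show ?thesis
          by (rule ev_mono[OF eD[OF 2(2)]]) (use CD xC 2 Tk_right x y in simp)
      qed
    qed
    then show ?thesis
      using x y CD xC yD by (auto simp: star_def uv op_def)
  qed
  obtain g :: "'a \<times> nat \<Rightarrow> 'a" where "inj g"
    using inj_prod_nat[OF infinite_UNIV] by blast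
  show False
  proof (rule no_limit_point[where g = "\<lambda>(x, b). g (x, if b then 1 else 0)" and P = "X \<times> UNIV"
        and \<S> = "star ` {B. dec B}" and op = op and \<iota> = "\<lambda>x. (x, False)" and q = "(x0, True)"])
    show "inj_on (\<lambda>(x, b). g (x, if b then 1 else 0)) (X \<times> UNIV)"
      by (rule inj_onI) (use \<open>inj g\<close> in \<open>auto simp: inj_eq split: if_splits\<close>)
    show "semigroup_on (X \<times> UNIV) op"
      by (auto simp: semigroup_on_def op_def mul_assoc)
    show "B \<subseteq> X \<times> UNIV" if "B \<in> star ` {B. dec B}" for B
      using that by (auto simp: star_def)
    show "X \<times> UNIV - B \<in> star ` {B. dec B}" if B: "B \<in> star ` {B. dec B}" for B
    proof -
      obtain C where C: "dec C" "B = star C" using B by blast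
      have ev_compl: "ev (\<lambda>k. (T ^^ k) x \<in> X - C) \<longleftrightarrow> ev (\<lambda>k. (T ^^ k) x \<notin> C)" if "x \<in> X" for x
        using Tk that by simp
      have "ev (\<lambda>k. (T ^^ k) x \<notin> C) \<longleftrightarrow> \<not> ev (\<lambda>k. (T ^^ k) x \<in> C)" if "x \<in> X" for x
        using C that ev_not[of "\<lambda>k. (T ^^ k) x \<in> C"] by (auto simp: dec_def)
      then have "X \<times> UNIV - B = star (X - C)"
        unfolding C star_def using ev_compl by (auto split: if_splits)
      moreover have "dec (X - C)"
        using C(1) Tk by (auto simp: dec_def)
      ultimately show ?thesis by blast
    qed
    show "\<exists>U\<in>star ` {B. dec B}. \<exists>V\<in>star ` {B. dec B}. p \<in> U \<and> q \<in> V \<and> (\<forall>u\<in>U. \<forall>v\<in>V. op u v \<in> B)"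
      if B: "B \<in> star ` {B. dec B}" and "p \<in> X \<times> UNIV" "q \<in> X \<times> UNIV" and opB: "op p q \<in> B" for B p q
    proof -
      obtain A where A: "dec A" "B = star A" using B by blast
      obtain x b y c where pq: "p = (x, b)" "q = (y, c)" by (cases p, cases q)
      have x: "x \<in> X" and y: "y \<in> X" using that pq by auto
      have ev_tail: "ev (\<lambda>k. (T ^^ k) w \<in> tail n w)" for w n
        unfolding ev_def tail_def by blast
      obtain n where n: "\<And>k. k > 0 \<Longrightarrow> fact n dvd k \<Longrightarrow> b \<or> c \<Longrightarrow> (T ^^ k) (mul x y) \<in> A"
        using opB by (auto simp: A pq star_def op_def ev_def split: if_splits)
      have A0: "mul x y \<in> A" if "\<not> b" "\<not> c"
        using \<open>op p q \<in> B\<close> that by (simp add: A pq star_def op_def)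
      \<comment> \<open>Exponents drawn from these tails add up to a multiple of \<open>n!\<close>,
        positive as soon as \<open>b\<close> or \<open>c\<close> holds, so \<open>n\<close> controls
        every product.\<close>
      define C where "C = (if b then tail n x else {x})"
      define D where "D = (if c then tail n y else {y})"
      have tail_or: "\<exists>k. u = (T ^^ k) w \<and> fact n dvd k \<and> (k = 0 \<longleftrightarrow> \<not> d)"
        if "u \<in> (if d then tail n w else {w})" for u w d
        using that by (cases d) (auto simp: tail_def intro: exI[of _ 0])
      have CD: "mul u v \<in> A" if uC: "u \<in> C" and vD: "v \<in> D" for u v
      proof -
        obtain k l where k: "u = (T ^^ k) x" "fact n dvd k" "k = 0 \<longleftrightarrow> \<not> b"
          and l: "v = (T ^^ l) y" "fact n dvd l" "l = 0 \<longleftrightarrow> \<not> c"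
          using tail_or[OF uC[unfolded C_def]] tail_or[OF vD[unfolded D_def]] by blast
        have "mul u v = (T ^^ (k + l)) (mul x y)"
          using Tk_prod x y k l by simp
        moreover have "fact n dvd k + l" using k l by simp
        ultimately show ?thesis using A0 n[of "k + l"] k(3) l(3) by (cases "b \<or> c") auto
      qed
      have "dec C" "dec D" using dec_tail dec_singleton x y by (auto simp: C_def D_def)
      moreover have "p \<in> star C" "q \<in> star D"
        using x y ev_tail by (auto simp: pq C_def D_def star_def)
      moreover have "op u v \<in> B" if "u \<in> star C" "v \<in> star D" for u v
        unfolding A
        by (rule star_prod[OF A(1) _ _ CD that]) (use \<open>dec C\<close> \<open>dec D\<close> in \<open>auto simp: dec_def\<close>)
      ultimately show ?thesis by blast
    qed
    show "semigroup_hom_on X mul (X \<times> UNIV) op (\<lambda>x. (x, False))"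
      by (auto simp: semigroup_hom_on_def op_def)
    show "\<exists>B\<in>star ` {B. dec B}. (x, False) \<in> B \<and> (y, False) \<notin> B" if "x \<in> X" "y \<in> X" "x \<noteq> y" for x y
      using dec_singleton[OF that(1)] that by (intro bexI[of _ "star {x}"]) (auto simp: star_def)
    show "(x0, True) \<in> X \<times> UNIV" using x0 by simp
    show "\<exists>B\<in>star ` {B. dec B}. (x0, True) \<in> B \<and> (x, False) \<notin> B" if "x \<in> X" for x
    proof -
      have "(T ^^ i) x0 = (T ^^ j) x0 \<longrightarrow> i = j" for i j
        using no_repeat by (metis linorder_neqE_nat)
      then obtain k0 where k0: "\<And>k. k > k0 \<Longrightarrow> (T ^^ k) x0 \<noteq> x"
        by (metis less_irrefl)
      have "ev (\<lambda>k. (T ^^ k) x0 \<notin> {x})"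
        by (rule ev_mono[OF ev_large[of k0]]) (use k0 in simp)
      then have "ev (\<lambda>k. (T ^^ k) x0 \<in> X - {x})" using Tk x0 by simp
      moreover have "dec (X - {x})"
        using dec_singleton[OF that] Tk by (auto simp: dec_def)
      ultimately show ?thesis
        using x0 by (intro bexI[of _ "star (X - {x})"]) (auto simp: star_def)
    qed
    show "\<exists>x\<in>X. \<forall>B\<in>\<F>. (x, False) \<in> B"
      if "finite \<F>" "\<F> \<subseteq> star ` {B. dec B}" "\<And>B. B \<in> \<F> \<Longrightarrow> (x0, True) \<in> B" for \<F>
    proof -
      have "ev (\<lambda>k. \<forall>B\<in>\<F>. ((T ^^ k) x0, False) \<in> B)"
        using that
      proof (induction rule: finite_induct)
        case empty
        then show ?case by (auto simp: ev_def)
      next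
        case (insert B \<F>)
        then obtain C where "dec C" "B = star C" by auto
        then have "ev (\<lambda>k. ((T ^^ k) x0, False) \<in> B)"
          using insert.prems(2)[of B] Tk x0 by (auto simp: star_def)
        from ev_conj[OF this insert.IH] insert.prems show ?case by simp
      qed
      then show ?thesis using ev_ex Tk x0 by blast
    qed
  qed
qed

end

section \<open>Limits of infinite sets with a constant product\<close>

context injectively_closed_sgrp
begin

text \<open>
  The limit point \<open>\<alpha>\<close> adjoined here is the limit of \<open>A\<close> along a free ultrafilter. As \<open>X\<close> need
  not have a unit, \<open>\<alpha>\<close> itself is the point \<open>(None, True)\<close>, with \<open>None\<close> an adjoined unit.
\<close>

lemma no_infinite_constant_square:
  assumes A: "infinite A" "A \<subseteq> X"
    and central: "\<And>a x. \<lbrakk>a \<in> A; x \<in> X\<rbrakk> \<Longrightarrow> mul x a = mul a x"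
    and s: "\<And>a b. \<lbrakk>a \<in> A; b \<in> A\<rbrakk> \<Longrightarrow> mul a b = s"
  shows False
proof -
  obtain F :: "'a filter" where F: "F \<le> inf cofinite (principal A)" "F \<noteq> bot"
    and ultra: "\<And>P. eventually P F \<or> eventually (\<lambda>x. \<not> P x) F"
  proof -
    have "inf cofinite (principal A) \<noteq> bot"
      using A by (simp add: trivial_limit_def eventually_inf_principal eventually_cofinite)
    then show ?thesis using ultrafilter_below that by blast
  qed
  have ev_A: "eventually (\<lambda>a. a \<in> A) F"
    using F(1) by (rule filter_leD) (simp add: eventually_inf_principal)
  have ev_ne: "eventually (\<lambda>a. a \<noteq> b) F" for b
    using F(1) by (rule filter_leD) (simp add: eventually_inf_principal eventually_cofinite)
  have ev_not: "eventually (\<lambda>x. \<not> P x) F \<longleftrightarrow> \<not> eventually P F" for P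
    using ultra[of P] F(2) eventually_conj[of P F "\<lambda>x. \<not> P x"]
    by (auto simp: trivial_limit_def)
  have ev_ex: "\<exists>a\<in>A. P a" if "eventually P F" for P
    using eventually_happens'[OF F(2) eventually_conj[OF that ev_A]] by blast
  define X1 where "X1 = insert None (Some ` X)"
  define m where "m x y = (case x of None \<Rightarrow> y | Some a \<Rightarrow>
    (case y of None \<Rightarrow> Some a | Some b \<Rightarrow> Some (mul a b)))" for x y
  have m_simps [simp]: "m None y = y" "m x None = x" "m (Some a) (Some b) = Some (mul a b)" for x y a b
    by (auto simp: m_def split: option.split)
  have m_closed [simp]: "m x y \<in> X1" if "x \<in> X1" "y \<in> X1" for x y
    using that by (auto simp: X1_def)
  have m_assoc: "m (m x y) z = m x (m y z)" if "x \<in> X1" "y \<in> X1" "z \<in> X1" for x y z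
    using that by (auto simp: X1_def mul_assoc)
  have A1 [simp]: "Some a \<in> X1" if "a \<in> A" for a
    using that A by (auto simp: X1_def)
  have m_central: "m x (Some a) = m (Some a) x" if "a \<in> A" "x \<in> X1" for a x
    using that central by (auto simp: X1_def)
  have m_s: "m (Some a) (Some b) = Some s" if "a \<in> A" "b \<in> A" for a b
    using s that by simp
  obtain a0 where a0: "a0 \<in> A" using A(1) by (metis ex_in_conv finite.emptyI)
  have s1 [simp]: "Some s \<in> X1"
    using m_closed[OF A1 A1, OF a0 a0] m_s a0 by simp
  have s_central: "m x (Some s) = m (Some s) x" if "x \<in> X1" for x
    using m_central[OF a0] m_assoc a0 that m_s[OF a0 a0] A1 by metis
  have move: "m (m x (Some a)) (m y (Some b)) = m (m x y) (m (Some a) (Some b))"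
    if "x \<in> X1" "y \<in> X1" "a \<in> A" "b \<in> A" for x y a b
  proof -
    have "m (m x (Some a)) (m y (Some b)) = m x (m (m (Some a) y) (Some b))"
      using that by (simp add: m_assoc del: m_simps)
    also have "\<dots> = m x (m (m y (Some a)) (Some b))"
      using that m_central by metis
    finally show ?thesis
      using that by (simp add: m_assoc del: m_simps)
  qed
  have move1: "m (m x (Some a)) y = m (m x y) (Some a)"
    if "x \<in> X1" "y \<in> X1" "a \<in> A" for x y a
    using that m_central m_assoc A1 by metis
  define star where "star B = {(x, b). x \<in> X1 \<and>
    (if b then eventually (\<lambda>a. m x (Some a) \<in> B) F else x \<in> B)}" for B
  \<comment> \<open>\<open>\<alpha>\<close> is central with square \<open>s\<close>: two limit
    factors contribute \<open>s\<close> and the flag returns to \<open>False\<close>, so flags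
    combine by exclusive or.\<close>
  define op where "op = (\<lambda>(x, b) (y, c).
    (if b \<and> c then m (m x y) (Some s) else m x y, b \<noteq> c))"
  have star_prod: "op u v \<in> star B"
    if CD: "\<And>c d. \<lbrakk>c \<in> C; d \<in> D\<rbrakk> \<Longrightarrow> m c d \<in> B" and u: "u \<in> star C" and v: "v \<in> star D" for B C D u v
  proof -
    obtain x b y c where uv: "u = (x, b)" "v = (y, c)" by (cases u, cases v)
    have x: "x \<in> X1" and y: "y \<in> X1" using u v by (auto simp: star_def uv)
    show ?thesis
    proof (cases b; cases c)
      assume bc: b c
      obtain a where a: "a \<in> A" "m x (Some a) \<in> C"
        using ev_ex[of "\<lambda>a. m x (Some a) \<in> C"] u bc by (auto simp: star_def uv)
      obtain a' where a': "a' \<in> A" "m y (Some a') \<in> D"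
        using ev_ex[of "\<lambda>a. m y (Some a) \<in> D"] v bc by (auto simp: star_def uv)
      have "m (m x y) (Some s) \<in> B"
        using CD[OF a(2) a'(2)] move[OF x y a(1) a'(1)] m_s[OF a(1) a'(1)] by metis
      then show ?thesis using x y bc by (simp add: op_def uv star_def)
    next
      assume bc: b "\<not> c"
      have "eventually (\<lambda>a. m x (Some a) \<in> C) F" "y \<in> D"
        using u v bc by (auto simp: star_def uv)
      from eventually_conj[OF this(1) ev_A] have "eventually (\<lambda>a. m (m x y) (Some a) \<in> B) F"
        by (rule eventually_mono) (use CD[OF _ \<open>y \<in> D\<close>] move1[OF x y] in metis)
      then show ?thesis using x y bc by (simp add: op_def uv star_def)
    next
      assume bc: "\<not> b" c
      have "eventually (\<lambda>a. m y (Some a) \<in> D) F" "x \<in> C"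
        using u v bc by (auto simp: star_def uv)
      from eventually_conj[OF this(1) ev_A] have "eventually (\<lambda>a. m (m x y) (Some a) \<in> B) F"
        by (rule eventually_mono) (use CD[OF \<open>x \<in> C\<close>] m_assoc[OF x y] A1 in metis)
      then show ?thesis using x y bc by (simp add: op_def uv star_def)
    next
      assume bc: "\<not> b" "\<not> c"
      then show ?thesis using u v CD x y by (simp add: op_def uv star_def)
    qed
  qed
  obtain g :: "'a \<times> nat \<Rightarrow> 'a" where "inj g"
    using inj_prod_nat[OF infinite_UNIV] by blast
  \<comment> \<open>\<open>None\<close> has no element of \<open>'a\<close> of its own. The labels 0
    to 3 keep its two points apart from all others, and \<open>s\<close> is an arbitrary
    filler.\<close>
  define code where
    "code = (\<lambda>(x, b). g (case x of None \<Rightarrow> (s, if b then 0 else 1) | Some a \<Rightarrow> (a, if b then 2 else 3)))"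
  show False
  proof (rule no_limit_point[where g = code and P = "X1 \<times> UNIV"
        and \<S> = "range star" and op = op and \<iota> = "\<lambda>x. (Some x, False)" and q = "(None, True)"])
    show "inj_on code (X1 \<times> UNIV)"
      by (rule inj_onI) (use \<open>inj g\<close> in \<open>auto simp: code_def inj_eq split: if_splits option.splits\<close>)
    show "semigroup_on (X1 \<times> UNIV) op"
      unfolding semigroup_on_def
    proof (intro conjI ballI)
      fix p q assume "p \<in> X1 \<times> (UNIV :: bool set)" "q \<in> X1 \<times> (UNIV :: bool set)"
      then show "op p q \<in> X1 \<times> UNIV" by (auto simp: op_def)
    next
      fix p q r
      assume pqr: "p \<in> X1 \<times> (UNIV :: bool set)" "q \<in> X1 \<times> (UNIV :: bool set)" "r \<in> X1 \<times> (UNIV :: bool set)"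
      obtain x b y c z d where eq: "p = (x, b)" "q = (y, c)" "r = (z, d)" by (cases p, cases q, cases r)
      have xyz: "x \<in> X1" "y \<in> X1" "z \<in> X1" using pqr eq by auto
      have "m (m (m x y) (Some s)) z = m (m x (m y z)) (Some s)"
        using xyz s_central by (simp add: m_assoc del: m_simps)
      moreover have "m x (m (m y z) (Some s)) = m (m x (m y z)) (Some s)"
        using xyz by (simp add: m_assoc del: m_simps)
      ultimately show "op (op p q) r = op p (op q r)"
        using xyz m_assoc by (simp add: eq op_def del: m_simps)
    qed
    show "B \<subseteq> X1 \<times> UNIV" if "B \<in> range star" for B
      using that by (auto simp: star_def)
    show "X1 \<times> UNIV - B \<in> range star" if "B \<in> range star" for B
    proof -
      from that obtain C where C: "B = star C" by blast
      have "X1 \<times> UNIV - B = star (- C)"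
        unfolding C star_def by (auto simp: ev_not split: if_splits)
      then show ?thesis by blast
    qed
    show "\<exists>U\<in>range star. \<exists>V\<in>range star. p \<in> U \<and> q \<in> V \<and> (\<forall>u\<in>U. \<forall>v\<in>V. op u v \<in> B)"
      if B: "B \<in> range star" and p: "p \<in> X1 \<times> UNIV" and q: "q \<in> X1 \<times> UNIV" and opB: "op p q \<in> B"
      for B p q
    proof -
      obtain C where C: "B = star C" using B by blast
      obtain x b y c where pq: "p = (x, b)" "q = (y, c)" by (cases p, cases q)
      have x: "x \<in> X1" and y: "y \<in> X1" using p q pq by auto
      have "\<exists>U V. p \<in> star U \<and> q \<in> star V \<and> (\<forall>u\<in>U. \<forall>v\<in>V. m u v \<in> C)"
      proof (cases b; cases c)
        \<comment> \<open>With two limit factors each product of \<open>xa\<close> and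
          \<open>ya'\<close> is the single point \<open>xys\<close>, so the whole of
          \<open>A\<close> gives neighbourhoods. With one limit factor, \<open>A\<close> is cut down
          to those \<open>a\<close> whose product lands in \<open>C\<close>.\<close>
        assume bc: b c
        have "p \<in> star ((\<lambda>a. m x (Some a)) ` A)" "q \<in> star ((\<lambda>a. m y (Some a)) ` A)"
          using x y bc ev_A by (auto simp: pq star_def elim!: eventually_mono)
        moreover have "m (m x (Some a)) (m y (Some a')) \<in> C" if "a \<in> A" "a' \<in> A" for a a'
          using move[OF x y that] m_s[OF that] opB bc by (simp add: C pq op_def star_def)
        ultimately show ?thesis by blast
      next
        assume bc: b "\<not> c"
        let ?A = "{a \<in> A. m (m x y) (Some a) \<in> C}"
        have "eventually (\<lambda>a. m (m x y) (Some a) \<in> C) F"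
          using opB bc by (simp add: C pq op_def star_def)
        from eventually_conj[OF ev_A this]
        have "p \<in> star ((\<lambda>a. m x (Some a)) ` ?A)" "q \<in> star {y}"
          using x y bc by (auto simp: pq star_def elim!: eventually_mono)
        moreover have "m (m x (Some a)) y \<in> C" if "a \<in> ?A" for a
          using that move1[OF x y] by simp
        ultimately show ?thesis by blast
      next
        assume bc: "\<not> b" c
        let ?A = "{a \<in> A. m (m x y) (Some a) \<in> C}"
        have "eventually (\<lambda>a. m (m x y) (Some a) \<in> C) F"
          using opB bc by (simp add: C pq op_def star_def)
        from eventually_conj[OF ev_A this]
        have "q \<in> star ((\<lambda>a. m y (Some a)) ` ?A)" "p \<in> star {x}"
          using x y bc by (auto simp: pq star_def elim!: eventually_mono)
        moreover have "m x (m y (Some a)) \<in> C" if "a \<in> ?A" for a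
          using that m_assoc[OF x y A1] by auto
        ultimately show ?thesis by blast
      next
        assume bc: "\<not> b" "\<not> c"
        have "p \<in> star {x}" "q \<in> star {y}" "m x y \<in> C"
          using opB x y bc by (auto simp: C pq op_def star_def)
        then show ?thesis by blast
      qed
      then obtain U V where "p \<in> star U" "q \<in> star V" "\<And>u v. \<lbrakk>u \<in> U; v \<in> V\<rbrakk> \<Longrightarrow> m u v \<in> C"
        by blast
      then have "\<forall>u\<in>star U. \<forall>v\<in>star V. op u v \<in> star C"
        by (intro ballI star_prod[of U V C])
      then show ?thesis unfolding C using \<open>p \<in> star U\<close> \<open>q \<in> star V\<close>
        by (intro bexI[of _ "star U"] bexI[of _ "star V"] conjI rangeI)
    qed
    show "semigroup_hom_on X mul (X1 \<times> UNIV) op (\<lambda>x. (Some x, False))"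
      by (auto simp: semigroup_hom_on_def op_def X1_def)
    show "\<exists>B\<in>range star. (Some x, False) \<in> B \<and> (Some y, False) \<notin> B" if "x \<in> X" "y \<in> X" "x \<noteq> y" for x y
      using that by (intro bexI[of _ "star {Some x}"]) (auto simp: star_def X1_def)
    show "(None, True) \<in> X1 \<times> UNIV" by (simp add: X1_def)
    show "\<exists>B\<in>range star. (None, True) \<in> B \<and> (Some x, False) \<notin> B" if "x \<in> X" for x
      using that ev_ne[of x] by (intro bexI[of _ "star (- {Some x})"]) (auto simp: star_def X1_def)
    show "\<exists>x\<in>X. \<forall>B\<in>\<F>. (Some x, False) \<in> B"
      if \<F>: "finite \<F>" "\<F> \<subseteq> range star" "\<And>B. B \<in> \<F> \<Longrightarrow> (None, True) \<in> B" for \<F>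
    proof -
      have "eventually (\<lambda>a. \<forall>B\<in>\<F>. (Some a, False) \<in> B) F"
      proof (rule eventually_ball_finite[OF \<F>(1)], intro ballI)
        fix B assume B: "B \<in> \<F>"
        then obtain C where C: "B = star C" using \<F>(2) by blast
        have "eventually (\<lambda>a. Some a \<in> C) F"
          using \<F>(3)[OF B] by (simp add: C star_def)
        from eventually_conj[OF this ev_A] show "eventually (\<lambda>a. (Some a, False) \<in> B) F"
          by (rule eventually_mono) (simp add: C star_def)
      qed
      then show ?thesis using ev_ex A(2) by blast
    qed
  qed
qed

end

section \<open>Characters of torsion abelian groups\<close>

definition circle_character :: "('a, 'b) monoid_scheme \<Rightarrow> 'a set \<Rightarrow> ('a \<Rightarrow> complex) \<Rightarrow> bool" where
  "circle_character G K \<psi> \<longleftrightarrow>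
     (\<forall>x\<in>K. cmod (\<psi> x) = 1) \<and> (\<forall>x\<in>K. \<forall>y\<in>K. \<psi> (x \<otimes>\<^bsub>G\<^esub> y) = \<psi> x * \<psi> y)"

text \<open>A nonpositive real part rules out the value 1 and survives passage to a limit. This is
  the source of all nontrivial character values below.\<close>

lemma circle_root:
  assumes "m \<ge> 2" and "cmod c = 1"
  shows "\<exists>r. r ^ m = c \<and> cmod r = 1 \<and> Re r \<le> 0"
proof -
  define \<phi> where "\<phi> = Arg2pi c"
  have c: "c = exp (\<i> * of_real \<phi>)"
    using Arg2pi_eq[of c] assms(2) by (simp add: \<phi>_def)
  have \<phi>: "0 \<le> \<phi>" "\<phi> < 2 * pi"
    by (simp_all add: \<phi>_def Arg2pi_ge_0 Arg2pi_lt_2pi)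
  \<comment> \<open>The arguments \<open>(\<phi> + 2\<pi>k)/m\<close> are spaced by at most \<open>\<pi>\<close>, so one of them lies in \<open>[\<pi>/2, 3\<pi>/2]\<close>.\<close>
  define k where "k = \<lceil>(m * pi / 2 - \<phi>) / (2 * pi)\<rceil>"
  define t where "t = (\<phi> + 2 * pi * of_int k) / m"
  have "(m * pi / 2 - \<phi>) / (2 * pi) \<le> of_int k" "of_int k - 1 < (m * pi / 2 - \<phi>) / (2 * pi)"
    unfolding k_def by linarith+
  then have *: "m * pi / 2 - \<phi> \<le> of_int k * (2 * pi)" "(of_int k - 1) * (2 * pi) < m * pi / 2 - \<phi>"
    by (simp_all only: pos_divide_le_eq pos_less_divide_eq pi_gt_zero mult_pos_pos zero_less_numeral)
  define a b where "a = m * pi" and "b = of_int k * pi"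
  have "a / 2 - \<phi> \<le> b * 2" "b * 2 - pi * 2 < a / 2 - \<phi>"
    using * by (simp_all add: a_def b_def algebra_simps)
  moreover have "pi * 2 \<le> a"
    using assms(1) by (simp add: a_def)
  ultimately have "a / 2 \<le> \<phi> + b * 2" "\<phi> + b * 2 \<le> 3 * a / 2"
    by simp_all
  then have "m * (pi / 2) \<le> \<phi> + 2 * pi * of_int k" "\<phi> + 2 * pi * of_int k \<le> m * (3 * pi / 2)"
    by (simp_all add: a_def b_def algebra_simps)
  then have t: "pi / 2 \<le> t" "t \<le> 3 * pi / 2"
    using assms(1) by (simp_all add: t_def pos_le_divide_eq pos_divide_le_eq mult.commute)
  have "cos (t - pi) \<ge> 0"
    using t by (intro cos_ge_zero) auto
  then have "cos t \<le> 0" by (simp add: cos_diff)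
  define r where "r = exp (\<i> * of_real t)"
  have "r ^ m = exp (of_nat m * (\<i> * of_real t))"
    unfolding r_def by (simp add: exp_of_nat_mult)
  also have "of_nat m * (\<i> * of_real t) = \<i> * of_real \<phi> + of_int (2 * k) * (of_real pi * \<i>)"
    using assms(1) by (simp add: t_def field_simps)
  also have "exp \<dots> = exp (\<i> * of_real \<phi>)"
    by (subst exp_eq) (auto simp: algebra_simps)
  finally have "r ^ m = c" using c by simp
  moreover have "cmod r = 1" by (simp add: r_def)
  moreover have "Re r \<le> 0" using \<open>cos t \<le> 0\<close> by (simp add: r_def Re_exp)
  ultimately show ?thesis by blast
qed

locale torsion_comm_group = comm_group +
  assumes torsion: "x \<in> carrier G \<Longrightarrow> \<exists>n>0. x [^] (n::nat) = \<one>"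
begin

text \<open>Natural exponents suffice for the subgroup generated by \<open>K\<close> and
  \<open>g\<close>, since torsion turns inverses of powers into powers.\<close>

definition adjoin :: "'a set \<Rightarrow> 'a \<Rightarrow> 'a set" where
  "adjoin K g = {k \<otimes> g [^] (i::nat) | k i. k \<in> K}"

lemma adjoinI: "k \<in> K \<Longrightarrow> k \<otimes> g [^] (i::nat) \<in> adjoin K g"
  by (auto simp: adjoin_def)

lemma
  assumes K: "subgroup K G" and g: "g \<in> carrier G"
  shows adjoin_subgroup: "subgroup (adjoin K g) G"
    and adjoin_superset: "K \<subseteq> adjoin K g"
    and adjoin_mem: "g \<in> adjoin K g"
    and adjoin_trivial: "g \<in> K \<Longrightarrow> adjoin K g = K"
    and adjoin_finite: "finite K \<Longrightarrow> finite (adjoin K g)"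
proof -
  interpret K: subgroup K G by (rule K)
  have prod: "(k \<otimes> g [^] i) \<otimes> (l \<otimes> g [^] j) = (k \<otimes> l) \<otimes> g [^] (i + j)" if "k \<in> K" "l \<in> K" for k l and i j :: nat
    using that g by (simp add: nat_pow_mult[symmetric] m_ac K.mem_carrier)
  obtain n :: nat where n: "n > 0" "g [^] n = \<one>" using torsion[OF g] by blast
  show "K \<subseteq> adjoin K g"
    using adjoinI[of _ K g 0] K.mem_carrier by fastforce
  show "g \<in> adjoin K g"
    using adjoinI[OF K.one_closed, of g 1] g by simp
  show "subgroup (adjoin K g) G"
  proof (rule subgroupI)
    show "adjoin K g \<subseteq> carrier G" using g K.mem_carrier by (auto simp: adjoin_def)
    show "adjoin K g \<noteq> {}" using adjoinI[OF K.one_closed] by blast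
    show "a \<otimes> b \<in> adjoin K g" if "a \<in> adjoin K g" "b \<in> adjoin K g" for a b
      using that prod adjoinI[OF K.m_closed] unfolding adjoin_def by fastforce
    show "inv a \<in> adjoin K g" if "a \<in> adjoin K g" for a
    proof -
      from that obtain k i where a: "a = k \<otimes> g [^] (i::nat)" "k \<in> K" by (auto simp: adjoin_def)
      \<comment> \<open>As \<open>g [^] n\<close> is the unit, the exponent
        \<open>(n - 1) * i\<close> completes \<open>i\<close> to a multiple of
        \<open>n\<close>.\<close>
      have "(k \<otimes> g [^] i) \<otimes> (inv k \<otimes> g [^] ((n - 1) * i)) = (k \<otimes> inv k) \<otimes> g [^] (i + (n - 1) * i)"
        using a by (intro prod) auto
      also have "i + (n - 1) * i = n * i" using n by (cases n) auto
      also have "(k \<otimes> inv k) \<otimes> g [^] (n * i) = \<one>"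
        using a n g by (simp add: nat_pow_pow[symmetric] K.mem_carrier)
      finally have "inv (k \<otimes> g [^] i) = inv k \<otimes> g [^] ((n - 1) * i)"
        using a g by (intro inv_unique'[symmetric]) (auto simp: K.mem_carrier m_comm)
      then show ?thesis using a adjoinI[of "inv k" K g] by simp
    qed
  qed
  show "adjoin K g = K" if "g \<in> K"
  proof
    have "g [^] i \<in> K" for i :: nat using that by (induction i) auto
    then show "adjoin K g \<subseteq> K" by (auto simp: adjoin_def)
  qed fact
  show "finite (adjoin K g)" if "finite K"
  proof -
    have "g [^] i = g [^] (i mod n)" for i
    proof -
      have "g [^] i = g [^] (n * (i div n) + i mod n)" by simp
      also have "\<dots> = g [^] (i mod n)"
        using n g by (simp only: nat_pow_mult[symmetric] nat_pow_pow[symmetric]) simp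
      finally show ?thesis .
    qed
    then have "adjoin K g \<subseteq> (\<lambda>(k, i). k \<otimes> g [^] i) ` (K \<times> {..<n})"
      using n unfolding adjoin_def by (force intro!: rev_image_eqI[of "(_, _ mod n)"])
    then show ?thesis using that by (auto intro: finite_subset)
  qed
qed

lemma character_one:
  assumes "subgroup K G" "circle_character G K \<psi>"
  shows "\<psi> \<one> = 1"
proof -
  have one: "\<one> \<in> K" using assms(1) by (rule subgroup.one_closed)
  then have "\<psi> (\<one> \<otimes> \<one>) = \<psi> \<one> * \<psi> \<one>"
    using assms(2) unfolding circle_character_def by blast
  moreover have "\<psi> \<one> \<noteq> 0"
    using assms(2) one unfolding circle_character_def by fastforce
  ultimately show ?thesis by simp
qed

text \<open>Let \<open>m\<close> be the order of \<open>g\<close> modulo \<open>K\<close>. The rule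
  sending \<open>k g^i\<close> to \<open>\<psi>(k) r^i\<close> is consistent when
  \<open>r^m = \<psi>(g^m)\<close>. If \<open>g \<notin> K\<close> then \<open>m \<ge> 2\<close>,
  which leaves the freedom to take \<open>r\<close> in the left half plane.\<close>

lemma extend_character:
  assumes K: "subgroup K G" and g: "g \<in> carrier G" and \<psi>: "circle_character G K \<psi>"
  shows "\<exists>\<psi>'. circle_character G (adjoin K g) \<psi>' \<and> (\<forall>x\<in>K. \<psi>' x = \<psi> x) \<and> (g \<notin> K \<longrightarrow> Re (\<psi>' g) \<le> 0)"
proof (cases "g \<in> K")
  case True
  then show ?thesis using adjoin_trivial[OF K g] \<psi> by auto
next
  case False
  interpret K: subgroup K G by (rule K)
  obtain n :: nat where "n > 0" "g [^] n = \<one>" using torsion[OF g] by blast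
  then have ex: "n > 0 \<and> g [^] n \<in> K" by simp
  define m where "m = (LEAST m::nat. m > 0 \<and> g [^] m \<in> K)"
  have m: "m > 0" "g [^] m \<in> K"
    using LeastI[of "\<lambda>m. m > 0 \<and> g [^] m \<in> K", OF ex] unfolding m_def by auto
  have m_least: "m \<le> i" if "i > 0" "g [^] i \<in> K" for i
    unfolding m_def using that by (intro Least_le) simp
  have "m \<noteq> 1" using m False g by auto
  then have "m \<ge> 2" using m by linarith
  obtain r where r: "r ^ m = \<psi> (g [^] m)" "cmod r = 1" "Re r \<le> 0"
    using circle_root[OF \<open>m \<ge> 2\<close>, of "\<psi> (g [^] m)"] \<psi> m by (auto simp: circle_character_def)
  have pow_K: "x [^] (q::nat) \<in> K \<and> \<psi> (x [^] q) = \<psi> x ^ q" if "x \<in> K" for x q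
    using that character_one[OF K \<psi>] \<psi> by (induction q) (auto simp: circle_character_def)
  have power_r: "m dvd i \<and> \<psi> (g [^] i) = r ^ i" if "g [^] i \<in> K" for i :: nat
  proof -
    define q s where "q = i div m" and "s = i mod m"
    have i: "i = m * q + s" by (simp add: q_def s_def)
    have gi: "g [^] i = (g [^] m) [^] q \<otimes> g [^] s"
      unfolding i using g by (simp add: nat_pow_mult[symmetric] nat_pow_pow)
    have "g [^] s = inv ((g [^] m) [^] q) \<otimes> g [^] i"
      unfolding gi using g by (simp add: m_assoc[symmetric])
    moreover have "inv ((g [^] m) [^] q) \<in> K" using pow_K[OF m(2)] by simp
    ultimately have "g [^] s \<in> K" using that by simp
    moreover have "s < m" using m(1) by (simp add: s_def)
    ultimately have "s = 0" using m_least[of s] by (meson gr0I leD)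
    then have "m dvd i" by (simp add: s_def mod_eq_0_iff_dvd)
    moreover have "\<psi> (g [^] i) = r ^ i"
      using pow_K[OF m(2), of q] r(1) i \<open>s = 0\<close> g by (simp add: nat_pow_pow power_mult)
    ultimately show ?thesis ..
  qed
  have le_unique: "\<psi> k * r ^ i = \<psi> l * r ^ j"
    if "k \<in> K" "l \<in> K" "k \<otimes> g [^] i = l \<otimes> g [^] j" "i \<le> j" for k l and i j :: nat
  proof -
    have "k \<otimes> g [^] i = (l \<otimes> g [^] (j - i)) \<otimes> g [^] i"
      using that g by (simp add: m_assoc nat_pow_mult K.mem_carrier)
    then have k: "k = l \<otimes> g [^] (j - i)"
      using that g by (simp add: K.mem_carrier)
    then have "g [^] (j - i) = inv l \<otimes> k"
      using that g by (simp add: m_assoc[symmetric] K.mem_carrier)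
    then have gK: "g [^] (j - i) \<in> K" using that by simp
    then have "\<psi> k = \<psi> l * r ^ (j - i)"
      using k power_r[OF gK] that \<psi> by (simp add: circle_character_def)
    then show ?thesis using that by (simp add: power_add[symmetric])
  qed
  have unique: "\<psi> k * r ^ i = \<psi> l * r ^ j"
    if "k \<in> K" "l \<in> K" "k \<otimes> g [^] i = l \<otimes> g [^] j" for k l and i j :: nat
    using le_unique[of k l i j] le_unique[of l k j i] that by (cases "i \<le> j") auto
  define \<psi>' where "\<psi>' x = (SOME c. \<exists>k\<in>K. \<exists>i::nat. x = k \<otimes> g [^] i \<and> c = \<psi> k * r ^ i)" for x
  have \<psi>': "\<psi>' (k \<otimes> g [^] i) = \<psi> k * r ^ i" if "k \<in> K" for k and i :: nat
    unfolding \<psi>'_def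
  proof (rule some_equality)
    show "\<exists>l\<in>K. \<exists>j::nat. k \<otimes> g [^] i = l \<otimes> g [^] j \<and> \<psi> k * r ^ i = \<psi> l * r ^ j"
      using that by (intro bexI[of _ k] exI[of _ i]) simp_all
    show "c = \<psi> k * r ^ i"
      if "\<exists>l\<in>K. \<exists>j::nat. k \<otimes> g [^] i = l \<otimes> g [^] j \<and> c = \<psi> l * r ^ j" for c
      using that unique[OF \<open>k \<in> K\<close>] by (elim bexE exE conjE) simp
  qed
  have "circle_character G (adjoin K g) \<psi>'"
    unfolding circle_character_def
  proof (intro conjI ballI)
    fix x assume "x \<in> adjoin K g"
    then obtain k i where x: "x = k \<otimes> g [^] (i::nat)" "k \<in> K" by (auto simp: adjoin_def)
    then show "cmod (\<psi>' x) = 1"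
      using \<psi>' \<psi> r(2) by (simp add: circle_character_def norm_mult norm_power)
    fix y assume "y \<in> adjoin K g"
    then obtain l j where y: "y = l \<otimes> g [^] (j::nat)" "l \<in> K" by (auto simp: adjoin_def)
    have "x \<otimes> y = (k \<otimes> l) \<otimes> g [^] (i + j)"
      using x y g by (simp add: nat_pow_mult[symmetric] m_ac K.mem_carrier)
    then show "\<psi>' (x \<otimes> y) = \<psi>' x * \<psi>' y"
      using x y \<psi>' \<psi> by (simp add: circle_character_def power_add)
  qed
  moreover have "\<psi>' x = \<psi> x" if "x \<in> K" for x
    using \<psi>'[OF that, of 0] that by (simp add: K.mem_carrier)
  moreover have "\<psi>' g = r"
    using \<psi>'[OF K.one_closed, of 1] g character_one[OF K \<psi>] by simp
  ultimately show ?thesis using r(3) by auto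
qed

text \<open>Successive extensions agree on the smaller subgroups and glue to a character of the
  union; along a countable chain dependent choice replaces Zorn's lemma.\<close>

lemma extend_character_chain:
  assumes K: "subgroup (K 0) G" and \<psi>0: "circle_character G (K 0) \<psi>0"
    and a: "\<And>n. a n \<in> carrier G" and K_Suc: "\<And>n. K (Suc n) = adjoin (K n) (a n)"
  shows "\<exists>\<psi>. circle_character G (\<Union>n. K n) \<psi> \<and> (\<forall>x\<in>K 0. \<psi> x = \<psi>0 x) \<and>
           (\<forall>n. a n \<notin> K n \<longrightarrow> Re (\<psi> (a n)) \<le> 0)"
proof -
  have sub: "subgroup (K n) G" for n
    by (induction n) (use K K_Suc a adjoin_subgroup in auto)
  have "\<exists>X. \<forall>n. (circle_character G (K n) (X n) \<and> (n = 0 \<longrightarrow> X n = \<psi>0)) \<and>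
      ((\<forall>x\<in>K n. X (Suc n) x = X n x) \<and> (a n \<notin> K n \<longrightarrow> Re (X (Suc n) (a n)) \<le> 0))"
  proof (rule dependent_nat_choice)
    show "\<exists>x. circle_character G (K 0) x \<and> (0 = (0::nat) \<longrightarrow> x = \<psi>0)" using \<psi>0 by auto
    fix x n assume "circle_character G (K n) x \<and> (n = 0 \<longrightarrow> x = \<psi>0)"
    then show "\<exists>y. (circle_character G (K (Suc n)) y \<and> (Suc n = 0 \<longrightarrow> y = \<psi>0)) \<and>
        (\<forall>z\<in>K n. y z = x z) \<and> (a n \<notin> K n \<longrightarrow> Re (y (a n)) \<le> 0)"
      using extend_character[OF sub a, of n x] unfolding K_Suc by auto
  qed
  then obtain X where X: "\<And>n. circle_character G (K n) (X n)" "X 0 = \<psi>0"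
    "\<And>n x. x \<in> K n \<Longrightarrow> X (Suc n) x = X n x" "\<And>n. a n \<notin> K n \<Longrightarrow> Re (X (Suc n) (a n)) \<le> 0"
    by metis
  have mono: "K i \<subseteq> K j" if "i \<le> j" for i j
    using that by (rule lift_Suc_mono_le[rotated]) (use adjoin_superset[OF sub a] K_Suc in auto)
  have agree: "X (n + d) x = X n x" if "x \<in> K n" for n d x
  proof (induction d)
    case (Suc d)
    have "x \<in> K (n + d)" using mono[of n "n + d"] that by auto
    then show ?case using X(3) Suc by simp
  qed simp
  define \<psi> where "\<psi> x = X (LEAST n. x \<in> K n) x" for x
  have \<psi>: "\<psi> x = X n x" if "x \<in> K n" for x n
  proof -
    have "x \<in> K (LEAST n. x \<in> K n)" "(LEAST n. x \<in> K n) \<le> n"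
      using that by (auto intro: LeastI Least_le)
    then show ?thesis unfolding \<psi>_def by (metis agree le_add_diff_inverse)
  qed
  have "circle_character G (\<Union>n. K n) \<psi>"
    unfolding circle_character_def
  proof (intro conjI ballI)
    fix x assume "x \<in> (\<Union>n. K n)"
    then obtain i where i: "x \<in> K i" by auto
    then show "cmod (\<psi> x) = 1" using \<psi> X(1) by (simp add: circle_character_def)
    fix y assume "y \<in> (\<Union>n. K n)"
    then obtain j where j: "y \<in> K j" by auto
    define n where "n = max i j"
    have n: "x \<in> K n" "y \<in> K n" using mono[of i n] mono[of j n] i j by (auto simp: n_def)
    then have "x \<otimes> y \<in> K n" using sub by (meson subgroup.m_closed)
    then show "\<psi> (x \<otimes> y) = \<psi> x * \<psi> y"
      using n \<psi> X(1)[of n] by (simp add: circle_character_def)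
  qed
  moreover have "\<psi> x = \<psi>0 x" if "x \<in> K 0" for x using \<psi>[OF that] X(2) by simp
  moreover have "Re (\<psi> (a n)) \<le> 0" if "a n \<notin> K n" for n
  proof -
    have "a n \<in> K (Suc n)" using adjoin_mem[OF sub a] K_Suc by simp
    then show ?thesis using \<psi> X(4)[OF that] by simp
  qed
  ultimately show ?thesis by blast
qed

text \<open>\<open>H\<close> is the union of a strictly increasing chain of subgroups
  \<open>K n\<close>, finite by torsion, with \<open>h n\<close> outside \<open>K n\<close>. For the
  first family, \<open>g\<close> is adjoined to \<open>S\<close> with a value in the left half plane
  before all the \<open>h n\<close>. For the second, a character trivial on the stage containing
  \<open>g\<close> is pushed into the left half plane at every later \<open>h i\<close>.\<close>

lemma countable_subgroup_with_characters:
  assumes inf: "infinite (carrier G)"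
  obtains H and h :: "nat \<Rightarrow> 'a" where "subgroup H G" "countable H" "\<And>i. h i \<in> H"
    and "\<And>S g. \<lbrakk>subgroup S G; g \<in> H - S\<rbrakk> \<Longrightarrow>
      \<exists>\<psi>. circle_character G H \<psi> \<and> (\<forall>x\<in>S \<inter> H. \<psi> x = 1) \<and> \<psi> g \<noteq> 1"
    and "\<And>g. g \<in> H \<Longrightarrow>
      \<exists>\<psi>. circle_character G H \<psi> \<and> \<psi> g = 1 \<and> (\<forall>\<^sub>F i in sequentially. Re (\<psi> (h i)) \<le> 0)"
proof -
  have "\<exists>K. \<forall>n::nat. (subgroup (K n) G \<and> finite (K n) \<and> (n = 0 \<longrightarrow> K n = {\<one>})) \<and>
      (\<exists>a\<in>carrier G. a \<notin> K n \<and> K (Suc n) = adjoin (K n) a)"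
  proof (rule dependent_nat_choice)
    show "\<exists>x. subgroup x G \<and> finite x \<and> (0 = (0::nat) \<longrightarrow> x = {\<one>})" using triv_subgroup by blast
    fix x :: "'a set" and n :: nat assume x: "subgroup x G \<and> finite x \<and> (n = 0 \<longrightarrow> x = {\<one>})"
    then have "carrier G - x \<noteq> {}" using inf by (metis Diff_eq_empty_iff finite_subset)
    then obtain a where "a \<in> carrier G" "a \<notin> x" by blast
    then show "\<exists>y. (subgroup y G \<and> finite y \<and> (Suc n = 0 \<longrightarrow> y = {\<one>})) \<and> (\<exists>a\<in>carrier G. a \<notin> x \<and> y = adjoin x a)"
      using x adjoin_subgroup adjoin_finite by blast
  qed
  then obtain K h where K: "\<And>n. subgroup (K n) G" "\<And>n. finite (K n)" "K 0 = {\<one>}"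
    and h: "\<And>n. h n \<in> carrier G" "\<And>n. h n \<notin> K n" and K_Suc: "\<And>n. K (Suc n) = adjoin (K n) (h n)"
    by metis
  have mono: "K i \<subseteq> K j" if "i \<le> j" for i j
    using that by (rule lift_Suc_mono_le[rotated]) (use adjoin_superset[OF K(1) h(1)] K_Suc in auto)
  define H where "H = (\<Union>n. K n)"
  have H: "subgroup H G"
  proof (rule subgroupI)
    show "H \<subseteq> carrier G" using K(1) subgroup.subset unfolding H_def by blast
    show "H \<noteq> {}" using K(1) subgroup.one_closed unfolding H_def by blast
    show "inv a \<in> H" if "a \<in> H" for a
      using that subgroup.m_inv_closed[OF K(1)] by (auto simp: H_def)
    show "a \<otimes> b \<in> H" if ab: "a \<in> H" "b \<in> H" for a b
    proof -
      obtain i j where "a \<in> K i" "b \<in> K j" using ab by (auto simp: H_def)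
      then have "a \<in> K (max i j)" "b \<in> K (max i j)"
        using mono[of i "max i j"] mono[of j "max i j"] by auto
      then have "a \<otimes> b \<in> K (max i j)" using K(1) by (meson subgroup.m_closed)
      then show ?thesis by (auto simp: H_def)
    qed
  qed
  have "countable H" unfolding H_def using K(2) by (simp add: countable_finite)
  have hH: "h i \<in> H" for i
    using adjoin_mem[OF K(1) h(1), of i i] K_Suc unfolding H_def by blast
  have const: "circle_character G S (\<lambda>_. 1)" for S by (simp add: circle_character_def)
  have restrict: "circle_character G A \<psi>" if "circle_character G B \<psi>" "A \<subseteq> B" for A B \<psi>
    using that unfolding circle_character_def by blast
  have part1: "\<exists>\<psi>. circle_character G H \<psi> \<and> (\<forall>x\<in>S \<inter> H. \<psi> x = 1) \<and> \<psi> g \<noteq> 1"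
    if S: "subgroup S G" and gS: "g \<in> H - S" for S g
  proof -
    have g: "g \<in> carrier G" using gS subgroup.mem_carrier[OF H] by simp
    obtain \<psi>0 where \<psi>0: "circle_character G (adjoin S g) \<psi>0" "\<forall>x\<in>S. \<psi>0 x = 1" "Re (\<psi>0 g) \<le> 0"
      using extend_character[OF S g const] gS by auto
    \<comment> \<open>The tower over \<open>S\<close> and \<open>g\<close> adjoins the same elements
      \<open>h n\<close>, so it contains every \<open>K n\<close> and hence \<open>H\<close>, to
      which the character is then restricted.\<close>
    define L where "L = rec_nat (adjoin S g) (\<lambda>n A. adjoin A (h n))"
    have L: "L 0 = adjoin S g" "\<And>n. L (Suc n) = adjoin (L n) (h n)" by (simp_all add: L_def)
    have sub: "subgroup (L n) G" for n
      by (induction n) (use L adjoin_subgroup S g h in auto)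
    obtain \<psi> where \<psi>: "circle_character G (\<Union>n. L n) \<psi>" "\<forall>x\<in>L 0. \<psi> x = \<psi>0 x"
      using extend_character_chain[of L \<psi>0 h] sub[of 0] \<psi>0(1) h(1) L by auto
    have "K n \<subseteq> L n" for n
    proof (induction n)
      case 0
      then show ?case using K(3) sub subgroup.one_closed by auto
    next
      case (Suc n)
      then show ?case unfolding K_Suc L(2) by (auto simp: adjoin_def)
    qed
    then have "H \<subseteq> (\<Union>n. L n)" unfolding H_def by blast
    moreover have "S \<subseteq> L 0" "g \<in> L 0"
      unfolding L using adjoin_superset[OF S g] adjoin_mem[OF S g] .
    moreover have "\<psi>0 g \<noteq> 1" using \<psi>0(3) by auto
    ultimately show ?thesis
      using restrict[OF \<psi>(1)] \<psi>(2) \<psi>0(2) by (intro exI[of _ \<psi>]) (auto simp: subset_iff)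
  qed
  have part2: "\<exists>\<psi>. circle_character G H \<psi> \<and> \<psi> g = 1 \<and> (\<forall>\<^sub>F i in sequentially. Re (\<psi> (h i)) \<le> 0)"
    if gH: "g \<in> H" for g
  proof -
    obtain j where j: "g \<in> K j" using gH by (auto simp: H_def)
    obtain \<psi> where \<psi>: "circle_character G (\<Union>n. K (j + n)) \<psi>" "\<forall>x\<in>K j. \<psi> x = 1"
      "\<forall>n. Re (\<psi> (h (j + n))) \<le> 0"
      using extend_character_chain[of "\<lambda>n. K (j + n)" "\<lambda>_. 1" "\<lambda>n. h (j + n)"] K(1) const h K_Suc by auto
    have "H \<subseteq> (\<Union>n. K (j + n))"
    proof
      fix x assume "x \<in> H"
      then obtain i where "x \<in> K i" by (auto simp: H_def)
      then have "x \<in> K (j + i)" using mono[of i "j + i"] by auto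
      then show "x \<in> (\<Union>n. K (j + n))" by blast
    qed
    moreover have "\<forall>\<^sub>F i in sequentially. Re (\<psi> (h i)) \<le> 0"
      using eventually_ge_at_top[of j] by (rule eventually_mono) (use \<psi>(3) le_Suc_ex in blast)
    ultimately show ?thesis using restrict[OF \<psi>(1)] \<psi>(2) j by blast
  qed
  show ?thesis
    by (rule that[OF H \<open>countable H\<close> hH part1 part2])
qed

end

section \<open>Infinite central groups\<close>

context injectively_closed_sgrp
begin

text \<open>
  The points \<open>(x, j)\<close> below stand for \<open>x\<eta>\<^sup>j\<close>, where \<open>\<eta>\<close> is a cluster point of the sequence \<open>h\<close> in
  the Bohr compactification of \<open>H\<close>; an \<open>H\<close>-orbit in \<open>eX\<close> carries the topology given by the
  characters of \<open>H\<close> that are trivial on the stabilizer, and the points outside \<open>eX\<close> are isolated.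
\<close>

lemma no_infinite_central_group:
  assumes group: "torsion_comm_group \<lparr>carrier = A, monoid.mult = mul, one = e\<rparr>"
    and A: "A \<subseteq> X" "infinite A"
    and central: "\<And>a x. \<lbrakk>a \<in> A; x \<in> X\<rbrakk> \<Longrightarrow> mul x a = mul a x"
  shows False
proof -
  let ?G = "\<lparr>carrier = A, monoid.mult = mul, one = e\<rparr>"
  interpret G: torsion_comm_group ?G by (rule group)
  have inf: "infinite (carrier ?G)" using A(2) by simp
  obtain H and h :: "nat \<Rightarrow> 'a" where H: "subgroup H ?G" "countable H" and h: "\<And>i. h i \<in> H"
    and separate: "\<And>S g. subgroup S ?G \<Longrightarrow> g \<in> H - S \<Longrightarrow>
       \<exists>\<psi>. circle_character ?G H \<psi> \<and> (\<forall>x\<in>S \<inter> H. \<psi> x = 1) \<and> \<psi> g \<noteq> 1"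
    and escape: "\<And>g. g \<in> H \<Longrightarrow>
       \<exists>\<psi>. circle_character ?G H \<psi> \<and> \<psi> g = 1 \<and> (\<forall>\<^sub>F i in sequentially. Re (\<psi> (h i)) \<le> 0)"
    by (fact G.countable_subgroup_with_characters[OF inf])
  interpret H: subgroup H ?G by (rule H)
  have HA: "g \<in> A" if "g \<in> H" for g using H.subset that by auto
  have HX [simp]: "g \<in> X" if "g \<in> H" for g using HA[OF that] A(1) by auto
  have eH [simp]: "e \<in> H" using H.one_closed by simp
  have H_mul [simp]: "mul a b \<in> H" if "a \<in> H" "b \<in> H" for a b
    using H.m_closed that by simp
  have e_left [simp]: "mul e a = a" if "a \<in> H" for a
    using G.l_one[of a] HA[OF that] by simp
  have H_inv: "\<exists>b\<in>H. mul b a = e" if "a \<in> H" for a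
    using G.l_inv[of a] HA[OF that] H.m_inv_closed[OF that] by auto
  have comm: "mul x a = mul a x" if "a \<in> H" "x \<in> X" for a x
    using central[OF HA] that by simp
  have lcomm: "mul x (mul a y) = mul a (mul x y)" if "a \<in> H" "x \<in> X" "y \<in> X" for a x y
    using that comm[of a x] by (simp add: mul_assoc[symmetric])
  have ee [simp]: "mul e (mul a x) = mul a x" if "a \<in> H" "x \<in> X" for a x
    using that by (simp add: mul_assoc[symmetric])

  define D where "D \<psi> \<longleftrightarrow> circle_character ?G H \<psi>" for \<psi>
  have D_norm: "cmod (\<psi> a) = 1" if "D \<psi>" "a \<in> H" for \<psi> a
    using that by (auto simp: D_def circle_character_def)
  have D_mul: "\<psi> (mul a b) = \<psi> a * \<psi> b" if "D \<psi>" "a \<in> H" "b \<in> H" for \<psi> a b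
    using that by (auto simp: D_def circle_character_def)
  have D_one: "\<psi> e = 1" if "D \<psi>" for \<psi>
    using G.character_one[OF H(1)] that by (auto simp: D_def)
  have D_const: "D (\<lambda>_. 1)" by (simp add: D_def circle_character_def)

  \<comment> \<open>Character values lie on the compact unit circle, so along an ultrafilter each
    character has a limit on the sequence \<open>h\<close>. The family \<open>\<eta>\<close> of
    these limits is the cluster point itself.\<close>
  obtain F :: "nat filter" where F: "F \<le> sequentially" "F \<noteq> bot"
    and ultra: "\<And>P. eventually P F \<or> eventually (\<lambda>x. \<not> P x) F"
    using ultrafilter_below[of sequentially] by auto
  have "\<exists>c. cmod c = 1 \<and> ((\<lambda>i. \<psi> (h i)) \<longlongrightarrow> c) F" if "D \<psi>" for \<psi>
  proof -
    have "filtermap (\<lambda>i. \<psi> (h i)) F \<noteq> bot" using F(2) by (simp add: filtermap_bot_iff)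
    moreover have "eventually (\<lambda>z. z \<in> sphere 0 1) (filtermap (\<lambda>i. \<psi> (h i)) F)"
      using D_norm[OF that h] by (simp add: eventually_filtermap)
    moreover have "compact (sphere (0::complex) 1)" by simp
    ultimately obtain c where c: "c \<in> sphere 0 1" "inf (nhds c) (filtermap (\<lambda>i. \<psi> (h i)) F) \<noteq> bot"
      unfolding compact_filter by blast
    have "eventually (\<lambda>i. \<psi> (h i) \<in> S) F" if "open S" "c \<in> S" for S
    proof (rule ccontr)
      assume "\<not> eventually (\<lambda>i. \<psi> (h i) \<in> S) F"
      then have "eventually (\<lambda>i. \<psi> (h i) \<notin> S) F" using ultra by blast
      then have "eventually (\<lambda>z. z \<notin> S) (filtermap (\<lambda>i. \<psi> (h i)) F)"
        by (simp add: eventually_filtermap)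
      moreover have "eventually (\<lambda>z. z \<in> S) (nhds c)"
        using that by (rule eventually_nhds_in_open)
      ultimately have "eventually (\<lambda>z. False) (inf (nhds c) (filtermap (\<lambda>i. \<psi> (h i)) F))"
        unfolding eventually_inf by blast
      then show False using c(2) by (simp add: trivial_limit_def)
    qed
    then show ?thesis using c(1) by (intro exI[of _ c]) (auto intro: topological_tendstoI)
  qed
  then obtain \<eta> where \<eta>: "\<And>\<psi>. D \<psi> \<Longrightarrow> cmod (\<eta> \<psi>) = 1" "\<And>\<psi>. D \<psi> \<Longrightarrow> ((\<lambda>i. \<psi> (h i)) \<longlongrightarrow> \<eta> \<psi>) F"
    by metis

  define P where "P = X \<times> (UNIV :: nat set)"
  define op where "op = (\<lambda>(x, i) (y, j). (mul x y, i + j :: nat))"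
  \<comment> \<open>The elements \<open>a\<close> with \<open>ax = ex\<close> form the stabilizer of
    \<open>ex\<close>. For a character trivial on it, \<open>\<psi> a\<close> depends only on
    \<open>ax\<close>, so \<open>\<psi>\<close> makes sense on the orbit.\<close>
  define triv where "triv \<psi> x \<longleftrightarrow> D \<psi> \<and> (\<forall>a\<in>H. mul a x = mul e x \<longrightarrow> \<psi> a = 1)" for \<psi> x
  \<comment> \<open>Since \<open>e\<eta> = \<eta>\<close>, a point with positive exponent counts as
    a multiple of \<open>e\<close> whatever its first component is.\<close>
  define core where "core p \<longleftrightarrow> mul e (fst p) = fst p \<or> snd p > 0" for p :: "'a \<times> nat"
  \<comment> \<open>With \<open>ex' = ax\<close>, the number
    \<open>\<psi> a * \<eta> \<psi> ^ j'\<close> is the value of \<open>\<psi>\<close> at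
    \<open>x'\<eta>^j'\<close> measured from \<open>x\<close>. The relation says that
    \<open>\<psi>\<close> sees \<open>p'\<close> within distance \<open>r\<close> of
    \<open>p\<close> in the same orbit.\<close>
  define rel where "rel \<psi> p r p' \<longleftrightarrow> (\<exists>a\<in>H. mul e (fst p') = mul a (fst p) \<and>
      cmod (\<psi> a * \<eta> \<psi> ^ snd p' - \<eta> \<psi> ^ snd p) < r)" for \<psi> r and p p' :: "'a \<times> nat"
  define nb where "nb p \<psi> r = (if core p then {p' \<in> P. core p' \<and> rel \<psi> p r p'} else {p})" for p \<psi> r
  \<comment> \<open>Each point must have a neighbourhood that decides \<open>B\<close>, a condition
    symmetric in \<open>B\<close> and \<open>P - B\<close>. One character per point is enough, since
    \<open>\<S>\<close> is used as a subbase.\<close>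
  define \<S> where "\<S> = {B. B \<subseteq> P \<and> (\<forall>p\<in>P. \<exists>\<psi> r. triv \<psi> (fst p) \<and> r > 0 \<and> (nb p \<psi> r \<subseteq> B \<or> nb p \<psi> r \<inter> B = {}))}"
  have P_X: "fst p \<in> X" if "p \<in> P" for p using that by (auto simp: P_def)
  have triv_const: "triv (\<lambda>_. 1) x" for x by (simp add: triv_def D_const)
  have triv_D: "D \<psi>" if "triv \<psi> x" for \<psi> x using that by (simp add: triv_def)
  have op_P: "op p q \<in> P" if "p \<in> P" "q \<in> P" for p q
    using that by (auto simp: op_def P_def)
  have rel_self: "rel \<psi> p r p" if "p \<in> P" "D \<psi>" "r > 0" for \<psi> r p
    unfolding rel_def using that D_one[OF that(2)] by (intro bexI[of _ e]) auto
  have nb_self: "p \<in> nb p \<psi> r" if "p \<in> P" "D \<psi>" "r > 0" for \<psi> r p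
    using that rel_self by (simp add: nb_def)
  have nbD: "p' \<in> P" "core p' \<longleftrightarrow> core p" "rel \<psi> p r p'" "\<not> core p \<Longrightarrow> p' = p"
    if "p' \<in> nb p \<psi> r" "p \<in> P" "D \<psi>" "r > 0" for p' p \<psi> r
    using that rel_self by (auto simp: nb_def split: if_splits)
  have core_op: "core (op p q)" if "p \<in> P" "q \<in> P" "core p \<or> core q" for p q
  proof -
    have X: "fst p \<in> X" "fst q \<in> X" using that P_X by auto
    have "mul e (mul (fst p) (fst q)) = mul (mul e (fst p)) (fst q)"
      using X by (simp add: mul_assoc)
    moreover have "mul e (mul (fst p) (fst q)) = mul (fst p) (mul e (fst q))"
      using X lcomm[OF eH X] by simp
    ultimately show ?thesis
      using that(3) unfolding core_def op_def by (auto simp: split_beta)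
  qed
  \<comment> \<open>Distances add under multiplication because all values involved have modulus
    1.\<close>
  have nb_op: "op p' q' \<in> nb (op p q) \<psi> (r + s)"
    if pq: "p \<in> P" "q \<in> P" and D: "D \<psi>" and rs: "r > 0" "s > 0"
      and p': "p' \<in> nb p \<psi> r" and q': "q' \<in> nb q \<psi> s" for p q p' q' \<psi> r s
  proof (cases "core (op p q)")
    case False
    then have "\<not> core p" "\<not> core q" using core_op[OF pq] by blast+
    then have "p' = p" "q' = q"
      using nbD(4)[OF p' pq(1) D rs(1)] nbD(4)[OF q' pq(2) D rs(2)] by blast+
    then show ?thesis using nb_self[OF op_P[OF pq] D, of "r + s"] rs by simp
  next
    case True
    note p = nbD[OF p' pq(1) D rs(1)] and q = nbD[OF q' pq(2) D rs(2)]
    have "core (op p' q')"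
      using True core_op[OF p(1) q(1)] p(2,4) q(2,4) by blast
    moreover have "rel \<psi> (op p q) (r + s) (op p' q')"
    proof -
      obtain a where a: "a \<in> H" "mul e (fst p') = mul a (fst p)"
        "cmod (\<psi> a * \<eta> \<psi> ^ snd p' - \<eta> \<psi> ^ snd p) < r" using p(3) by (auto simp: rel_def)
      obtain b where b: "b \<in> H" "mul e (fst q') = mul b (fst q)"
        "cmod (\<psi> b * \<eta> \<psi> ^ snd q' - \<eta> \<psi> ^ snd q) < s" using q(3) by (auto simp: rel_def)
      note X = P_X[OF pq(1)] P_X[OF pq(2)] P_X[OF p(1)] P_X[OF q(1)]
      have "mul e (mul (fst p') (fst q')) = mul (mul e (fst p')) (mul e (fst q'))"
        using X lcomm[OF eH X(3,4)] by (simp add: mul_assoc)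
      also have "\<dots> = mul (mul a b) (mul (fst p) (fst q))"
        using X a(1) b(1) lcomm[OF b(1) X(1,2)] unfolding a(2) b(2) by (simp add: mul_assoc)
      finally have prod: "mul e (fst (op p' q')) = mul (mul a b) (fst (op p q))"
        by (simp add: op_def split_beta)
      have "\<psi> (mul a b) * \<eta> \<psi> ^ snd (op p' q') - \<eta> \<psi> ^ snd (op p q) =
          (\<psi> a * \<eta> \<psi> ^ snd p') * (\<psi> b * \<eta> \<psi> ^ snd q' - \<eta> \<psi> ^ snd q) +
          \<eta> \<psi> ^ snd q * (\<psi> a * \<eta> \<psi> ^ snd p' - \<eta> \<psi> ^ snd p)"
        using D_mul[OF D a(1) b(1)] by (simp add: op_def split_beta power_add algebra_simps)
      also have "cmod \<dots> \<le> cmod ((\<psi> a * \<eta> \<psi> ^ snd p') * (\<psi> b * \<eta> \<psi> ^ snd q' - \<eta> \<psi> ^ snd q)) +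
          cmod (\<eta> \<psi> ^ snd q * (\<psi> a * \<eta> \<psi> ^ snd p' - \<eta> \<psi> ^ snd p))"
        by (rule norm_triangle_ineq)
      also have "\<dots> < r + s"
        using a(3) b(3) D_norm[OF D a(1)] \<eta>(1)[OF D] by (simp add: norm_mult norm_power)
      finally show ?thesis
        unfolding rel_def using prod a(1) b(1) by (intro bexI[of _ "mul a b"]) auto
    qed
    ultimately show ?thesis using True op_P[OF p(1) q(1)] by (simp add: nb_def)
  qed
  have cancel: "mul a x = mul b x" 
    if c: "c \<in> H" and "a \<in> H" "b \<in> H" "x \<in> X" and eq: "mul c (mul a x) = mul c (mul b x)" for a b c x
  proof -
    obtain d where d: "d \<in> H" "mul d c = e" using H_inv[OF c] by blast
    have drop: "mul d (mul c (mul k x)) = mul k x" if "k \<in> H" for k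
      using that c d \<open>x \<in> X\<close> mul_assoc[of d c "mul k x"] by simp
    have "mul a x = mul d (mul c (mul a x))" using drop \<open>a \<in> H\<close> by simp
    also have "\<dots> = mul d (mul c (mul b x))" by (simp only: eq)
    also have "\<dots> = mul b x" using drop \<open>b \<in> H\<close> by simp
    finally show ?thesis .
  qed
  have triv_unique: "\<psi> a = \<psi> b"
    if triv: "triv \<psi> x" and x: "x \<in> X" and a: "a \<in> H" and b: "b \<in> H" and eq: "mul a x = mul b x" for \<psi> x a b
  proof -
    obtain c where c: "c \<in> H" "mul c a = e" using H_inv[OF a] by blast
    have "mul (mul c b) x = mul c (mul a x)"
      unfolding eq using c x b by (simp add: mul_assoc)
    also have "\<dots> = mul e x"
      using c x a mul_assoc[of c a x] by simp
    finally have "\<psi> (mul c b) = 1" using triv c b by (simp add: triv_def)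
    moreover have "\<psi> (mul c a) = 1" using c D_one[OF triv_D[OF triv]] by simp
    ultimately have "\<psi> c * \<psi> b = \<psi> c * \<psi> a"
      using D_mul[OF triv_D[OF triv] c(1)] a b by simp
    moreover have "\<psi> c \<noteq> 0" using D_norm[OF triv_D[OF triv] c(1)] by auto
    ultimately show ?thesis by simp
  qed
  have triv_orbit: "triv \<psi> x'"
    if "triv \<psi> x" "x \<in> X" "x' \<in> X" "a \<in> H" and ax: "mul e x' = mul a x" for \<psi> x x' a
    unfolding triv_def
  proof (intro conjI ballI impI)
    show "D \<psi>" using that triv_D by blast
    fix b assume b: "b \<in> H" "mul b x' = mul e x'"
    have "mul a (mul b x) = mul b (mul a x)"
      using b that lcomm by simp
    also have "\<dots> = mul b (mul e x')" by (simp only: ax)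
    also have "\<dots> = mul e (mul b x')" using b(1) that lcomm by simp
    also have "\<dots> = mul e (mul a x)" by (simp only: b(2) ax)
    also have "\<dots> = mul a (mul e x)" using that lcomm[of a e x] by simp
    finally have "mul b x = mul e x" using cancel[of a b e x] that b by simp
    then show "\<psi> b = 1" using b that by (simp add: triv_def)
  qed
  have isolated: "{p} \<in> \<S>" if p: "p \<in> P" "\<not> core p" for p
    unfolding \<S>_def
  proof (intro CollectI conjI ballI)
    show "{p} \<subseteq> P" using p by simp
    fix p' assume p': "p' \<in> P"
    have "nb p' (\<lambda>_. 1) 1 \<subseteq> {p} \<or> nb p' (\<lambda>_. 1) 1 \<inter> {p} = {}"
      using p nbD(2,4)[OF _ p' D_const, of p 1] by (cases "core p'") (auto simp: nb_def)
    then show "\<exists>\<psi> r. triv \<psi> (fst p') \<and> r > 0 \<and> (nb p' \<psi> r \<subseteq> {p} \<or> nb p' \<psi> r \<inter> {p} = {})"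
      using triv_const by (intro exI[of _ "\<lambda>_. 1"] exI[of _ 1]) auto
  qed
  have generic: "\<exists>r. 0 < r \<and> r \<le> r0 \<and> nb p \<psi> r \<in> \<S>"
    if p: "p \<in> P" and \<psi>: "triv \<psi> (fst p)" and r0: "r0 > 0" for p \<psi> and r0 :: real
  proof (cases "core p")
    case False
    then show ?thesis using isolated p r0 by (intro exI[of _ r0]) (simp add: nb_def)
  next
    case core: True
    note D = triv_D[OF \<psi>]
    \<comment> \<open>\<open>H\<close> is countable, so only countably many distances from
      \<open>p\<close> occur. A ball whose radius avoids them has an empty sphere, and so is
      clopen.\<close>
    define V where "V = (\<lambda>(a, j). cmod (\<psi> a * \<eta> \<psi> ^ j - \<eta> \<psi> ^ snd p)) ` (H \<times> (UNIV :: nat set))"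
    have "countable V" unfolding V_def using H(2) by auto
    then have "\<not> {0<..<r0} \<subseteq> V"
      using uncountable_open_interval[of 0 r0] r0 countable_subset by blast
    then obtain r where r: "0 < r" "r < r0" "r \<notin> V"
      unfolding subset_iff greaterThanLessThan_iff by blast
    have "nb p \<psi> r \<in> \<S>"
      unfolding \<S>_def
    proof (intro CollectI conjI ballI)
      show "nb p \<psi> r \<subseteq> P" using nbD(1)[OF _ p D r(1)] by blast
      fix p' assume p': "p' \<in> P"
      show "\<exists>\<psi>' r'. triv \<psi>' (fst p') \<and> r' > 0 \<and> (nb p' \<psi>' r' \<subseteq> nb p \<psi> r \<or> nb p' \<psi>' r' \<inter> nb p \<psi> r = {})"
      proof (cases "core p' \<and> (\<exists>a\<in>H. mul e (fst p') = mul a (fst p))")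
        case False
        \<comment> \<open>A neighbourhood of \<open>p'\<close> is \<open>{p'}\<close> or stays in
          the orbit of \<open>p'\<close>, and distinct orbits are disjoint; the trivial character
          therefore suffices.\<close>
        have "nb p' (\<lambda>_. 1) 1 \<inter> nb p \<psi> r = {}"
        proof (rule ccontr)
          assume "nb p' (\<lambda>_. 1) 1 \<inter> nb p \<psi> r \<noteq> {}"
          then obtain p'' where p'': "p'' \<in> nb p' (\<lambda>_. 1) 1" "p'' \<in> nb p \<psi> r" by blast
          note 1 = nbD[OF p''(1) p' D_const zero_less_one] and 2 = nbD[OF p''(2) p D r(1)]
          obtain a b where ab: "a \<in> H" "b \<in> H" "mul e (fst p'') = mul a (fst p')" "mul e (fst p'') = mul b (fst p)"
            using 1(3) 2(3) by (auto simp: rel_def)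
          obtain c where c: "c \<in> H" "mul c a = e" using H_inv ab by blast
          have "mul e (fst p') = mul c (mul a (fst p'))"
            using ab c P_X[OF p'] by (simp add: mul_assoc[symmetric])
          also have "\<dots> = mul (mul c b) (fst p)"
            unfolding ab(3)[symmetric] ab(4) using ab c P_X[OF p] by (simp add: mul_assoc)
          finally have "mul e (fst p') = mul (mul c b) (fst p)" .
          then have "\<exists>a\<in>H. mul e (fst p') = mul a (fst p)"
            by (rule bexI) (use c ab in simp)
          then show False using False 1(2) 2(2) core by simp
        qed
        then show ?thesis using triv_const by (intro exI[of _ "\<lambda>_. 1"] exI[of _ 1]) auto
      next
        case True
        then obtain a where a: "a \<in> H" "mul e (fst p') = mul a (fst p)" and core': "core p'" by blast
        define c where "c = cmod (\<psi> a * \<eta> \<psi> ^ snd p' - \<eta> \<psi> ^ snd p)"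
        have "c \<noteq> r" using r(3) a(1) unfolding V_def c_def by force
        then have r': "\<bar>r - c\<bar> > 0" by simp
        \<comment> \<open>Moving away from \<open>p'\<close> by less than
          \<open>\<bar>r - c\<bar>\<close> changes the distance \<open>c\<close> to \<open>p\<close>
          without crossing \<open>r\<close>.\<close>
        have near: "\<exists>b\<in>H. mul e (fst p'') = mul b (fst p) \<and>
            \<bar>cmod (\<psi> b * \<eta> \<psi> ^ snd p'' - \<eta> \<psi> ^ snd p) - c\<bar> < \<bar>r - c\<bar>"
          if p'': "p'' \<in> nb p' \<psi> \<bar>r - c\<bar>" for p''
        proof -
          obtain k where k: "k \<in> H" "mul e (fst p'') = mul k (fst p')"
            "cmod (\<psi> k * \<eta> \<psi> ^ snd p'' - \<eta> \<psi> ^ snd p') < \<bar>r - c\<bar>"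
            using nbD(3)[OF p'' p' D r'] by (auto simp: rel_def)
          have "mul e (fst p'') = mul e (mul k (fst p'))"
            using k P_X[OF p'] by simp
          also have "\<dots> = mul k (mul e (fst p'))"
            using k P_X[OF p'] lcomm[of e k] by simp
          also have "\<dots> = mul (mul k a) (fst p)"
            using k a P_X[OF p] by (simp add: mul_assoc)
          finally have eq: "mul e (fst p'') = mul (mul k a) (fst p)" .
          define u v where "u = \<psi> a * (\<psi> k * \<eta> \<psi> ^ snd p'' - \<eta> \<psi> ^ snd p')"
            and "v = \<psi> a * \<eta> \<psi> ^ snd p' - \<eta> \<psi> ^ snd p"
          have "\<psi> (mul k a) * \<eta> \<psi> ^ snd p'' - \<eta> \<psi> ^ snd p = u + v"
            using D_mul[OF D k(1) a(1)] by (simp add: u_def v_def algebra_simps)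
          moreover have "cmod u < \<bar>r - c\<bar>"
            using k(3) D_norm[OF D a(1)] by (simp add: u_def norm_mult)
          moreover have "\<bar>cmod (u + v) - cmod v\<bar> \<le> cmod u"
            using norm_triangle_ineq3[of "u + v" v] by simp
          ultimately have "\<bar>cmod (\<psi> (mul k a) * \<eta> \<psi> ^ snd p'' - \<eta> \<psi> ^ snd p) - c\<bar> < \<bar>r - c\<bar>"
            unfolding c_def v_def[symmetric] by simp
          then show ?thesis using eq k(1) a(1) by (intro bexI[of _ "mul k a"]) auto
        qed
        have core'': "core p''" "p'' \<in> P" if "p'' \<in> nb p' \<psi> \<bar>r - c\<bar>" for p''
          using nbD(1,2)[OF that p' D r'] core' by auto
        show ?thesis
        proof (intro exI conjI)
          show "triv \<psi> (fst p')" by (rule triv_orbit[OF \<psi> P_X[OF p] P_X[OF p'] a])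
          show "\<bar>r - c\<bar> > 0" by fact
          show "nb p' \<psi> \<bar>r - c\<bar> \<subseteq> nb p \<psi> r \<or> nb p' \<psi> \<bar>r - c\<bar> \<inter> nb p \<psi> r = {}"
          proof (cases "c < r")
            case True
            have "p'' \<in> nb p \<psi> r" if p'': "p'' \<in> nb p' \<psi> \<bar>r - c\<bar>" for p''
            proof -
              obtain b where "b \<in> H" "mul e (fst p'') = mul b (fst p)"
                "\<bar>cmod (\<psi> b * \<eta> \<psi> ^ snd p'' - \<eta> \<psi> ^ snd p) - c\<bar> < \<bar>r - c\<bar>"
                using near[OF p''] by blast
              then have "rel \<psi> p r p''" using True unfolding rel_def by (intro bexI[of _ b]) auto
              then show ?thesis using core core''[OF p''] by (simp add: nb_def)
            qed
            then show ?thesis by blast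
          next
            case False
            have "p'' \<notin> nb p \<psi> r" if p'': "p'' \<in> nb p' \<psi> \<bar>r - c\<bar>" for p''
            proof
              assume "p'' \<in> nb p \<psi> r"
              then obtain d where d: "d \<in> H" "mul e (fst p'') = mul d (fst p)"
                "cmod (\<psi> d * \<eta> \<psi> ^ snd p'' - \<eta> \<psi> ^ snd p) < r"
                using nbD(3)[OF _ p D r(1)] unfolding rel_def by blast
              obtain b where b: "b \<in> H" "mul e (fst p'') = mul b (fst p)"
                "\<bar>cmod (\<psi> b * \<eta> \<psi> ^ snd p'' - \<eta> \<psi> ^ snd p) - c\<bar> < \<bar>r - c\<bar>"
                using near[OF p''] by blast
              \<comment> \<open>The ball and \<open>near\<close> supply different witnesses for the
                same orbit point; triviality on the stabilizer makes their character values
                agree.\<close>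
              have "\<psi> d = \<psi> b" using triv_unique[OF \<psi> P_X[OF p] d(1) b(1)] d(2) b(2) by simp
              then show False using d(3) b(3) False by (simp add: abs_if split: if_splits)
            qed
            then show ?thesis by blast
          qed
        qed
      qed
    qed
    then show ?thesis using r by (intro exI[of _ r]) auto
  qed

  have compl: "P - B \<in> \<S>" if B: "B \<in> \<S>" for B
    unfolding \<S>_def
  proof (intro CollectI conjI ballI)
    fix p assume p: "p \<in> P"
    then obtain \<psi> r where \<psi>: "triv \<psi> (fst p)" "r > 0" "nb p \<psi> r \<subseteq> B \<or> nb p \<psi> r \<inter> B = {}"
      using B unfolding \<S>_def by blast
    moreover have "nb p \<psi> r \<subseteq> P" using nbD(1)[OF _ p triv_D[OF \<psi>(1)] \<psi>(2)] by blast
    ultimately show "\<exists>\<psi> r. triv \<psi> (fst p) \<and> r > 0 \<and> (nb p \<psi> r \<subseteq> P - B \<or> nb p \<psi> r \<inter> (P - B) = {})"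
      by (intro exI[of _ \<psi>] exI[of _ r]) blast
  qed simp
  have isolated_sep: "\<exists>B\<in>\<S>. p \<in> B \<and> p' \<notin> B" if "p \<in> P" "p' \<in> P" "\<not> core p'" "p \<noteq> p'" for p p'
    using compl[OF isolated[OF that(2,3)]] that by (intro bexI[of _ "P - {p'}"]) auto
  have core_sep: "\<exists>B\<in>\<S>. p \<in> B \<and> p' \<notin> B"
    if p: "p \<in> P" "p' \<in> P" "core p" and \<psi>: "triv \<psi> (fst p)"
      and far: "\<And>a. a \<in> H \<Longrightarrow> mul e (fst p') = mul a (fst p) \<Longrightarrow> \<psi> a * \<eta> \<psi> ^ snd p' \<noteq> \<eta> \<psi> ^ snd p"
    for p p' \<psi>
  proof -
    have "\<exists>r>0. \<forall>b\<in>H. mul e (fst p') = mul b (fst p) \<longrightarrow> r \<le> cmod (\<psi> b * \<eta> \<psi> ^ snd p' - \<eta> \<psi> ^ snd p)"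
    proof (cases "\<exists>a\<in>H. mul e (fst p') = mul a (fst p)")
      case True
      then obtain a where a: "a \<in> H" "mul e (fst p') = mul a (fst p)" by blast
      have "\<psi> b = \<psi> a" if "b \<in> H" "mul e (fst p') = mul b (fst p)" for b
        using triv_unique[OF \<psi> P_X[OF p(1)] that(1) a(1)] that(2) a(2) by simp
      then show ?thesis
        using far[OF a] by (intro exI[of _ "cmod (\<psi> a * \<eta> \<psi> ^ snd p' - \<eta> \<psi> ^ snd p)"]) auto
    next
      case False
      then show ?thesis by (intro exI[of _ 1]) auto
    qed
    then obtain r0 where r0: "r0 > 0"
      "\<And>b. b \<in> H \<Longrightarrow> mul e (fst p') = mul b (fst p) \<Longrightarrow> r0 \<le> cmod (\<psi> b * \<eta> \<psi> ^ snd p' - \<eta> \<psi> ^ snd p)"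
      by blast
    obtain r where r: "0 < r" "r \<le> r0" "nb p \<psi> r \<in> \<S>" using generic[OF p(1) \<psi> r0(1)] by blast
    have "\<not> rel \<psi> p r p'"
      unfolding rel_def using r0(2) r(2) by (meson not_le order_trans)
    then have "p' \<notin> nb p \<psi> r" using p(3) by (simp add: nb_def)
    then show ?thesis using r(3) nb_self[OF p(1) triv_D[OF \<psi>] r(1)] by blast
  qed
  obtain g :: "'a \<times> nat \<Rightarrow> 'a" where "inj g"
    using inj_prod_nat[OF infinite_UNIV] by blast
  show False
  proof (rule no_limit_point[where g = g and P = P and \<S> = \<S> and op = op and \<iota> = "\<lambda>x. (x, 0)" and q = "(e, 1)"])
    show "inj_on g P" using \<open>inj g\<close> by (rule inj_on_subset) simp
    show "semigroup_on P op"
      by (auto simp: semigroup_on_def op_def P_def mul_assoc)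
    show "B \<subseteq> P" if "B \<in> \<S>" for B
      using that by (simp add: \<S>_def)
    show "P - B \<in> \<S>" if "B \<in> \<S>" for B
      using that by (rule compl)
    show "\<exists>U\<in>\<S>. \<exists>V\<in>\<S>. p \<in> U \<and> q \<in> V \<and> (\<forall>u\<in>U. \<forall>v\<in>V. op u v \<in> B)"
      if B: "B \<in> \<S>" and p: "p \<in> P" and q: "q \<in> P" and opB: "op p q \<in> B" for B p q
    proof -
      obtain \<psi> r where \<psi>: "triv \<psi> (fst (op p q))" "r > 0" "nb (op p q) \<psi> r \<subseteq> B \<or> nb (op p q) \<psi> r \<inter> B = {}"
        using B op_P[OF p q] unfolding \<S>_def by blast
      note D = triv_D[OF \<psi>(1)]
      have sub: "nb (op p q) \<psi> r \<subseteq> B"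
        using \<psi>(3) nb_self[OF op_P[OF p q] D \<psi>(2)] opB by blast
      have tr: "\<psi> a = 1" if "a \<in> H" "mul a (mul (fst p) (fst q)) = mul e (mul (fst p) (fst q))" for a
        using \<psi>(1) that by (simp add: triv_def op_def split_beta)
      \<comment> \<open>Whatever stabilizes a factor stabilizes the product, so a character trivial
        on the stabilizer of the product is trivial on that of either factor.\<close>
      have "triv \<psi> (fst p)"
        unfolding triv_def using D tr P_X[OF p] P_X[OF q] by (metis HX eH mul_assoc)
      then obtain r1 where r1: "0 < r1" "r1 \<le> r / 2" "nb p \<psi> r1 \<in> \<S>"
        using generic[OF p, of \<psi> "r / 2"] \<psi>(2) by auto
      have "triv \<psi> (fst q)"
        unfolding triv_def using D tr P_X[OF p] P_X[OF q] by (metis eH lcomm)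
      then obtain r2 where r2: "0 < r2" "r2 \<le> r / 2" "nb q \<psi> r2 \<in> \<S>"
        using generic[OF q, of \<psi> "r / 2"] \<psi>(2) by auto
      have "nb (op p q) \<psi> (r1 + r2) \<subseteq> nb (op p q) \<psi> r"
        using r1(2) r2(2) by (force simp: nb_def rel_def)
      then have "\<forall>u\<in>nb p \<psi> r1. \<forall>v\<in>nb q \<psi> r2. op u v \<in> B"
        using nb_op[OF p q D r1(1) r2(1)] sub by blast
      then show ?thesis
        using r1 r2 nb_self[OF p D r1(1)] nb_self[OF q D r2(1)]
        by (intro bexI[of _ "nb p \<psi> r1"] bexI[of _ "nb q \<psi> r2"] conjI)
    qed
    show "semigroup_hom_on X mul P op (\<lambda>x. (x, 0))"
      by (auto simp: semigroup_hom_on_def op_def P_def)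
    show "\<exists>B\<in>\<S>. (x, 0) \<in> B \<and> (y, 0) \<notin> B" if xy: "x \<in> X" "y \<in> X" "x \<noteq> y" for x y
    proof -
      have P: "(x, 0) \<in> P" "(y, 0) \<in> P" using xy by (auto simp: P_def)
      consider "\<not> core (x, 0)" | "\<not> core (y, 0)" | "core (x, 0)" "core (y, 0)" by blast
      then show ?thesis
      proof cases
        case 1
        then show ?thesis using isolated[OF P(1)] xy(3) by (intro bexI[of _ "{(x, 0)}"]) auto
      next
        case 2
        then show ?thesis using isolated_sep[OF P] xy(3) by simp
      next
        case 3
        then have ex: "mul e x = x" "mul e y = y" by (simp_all add: core_def)
        have "\<exists>\<psi>. triv \<psi> x \<and> (\<forall>a\<in>H. y = mul a x \<longrightarrow> \<psi> a \<noteq> 1)"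
        proof (cases "\<exists>a\<in>H. y = mul a x")
          case True
          then obtain a where a: "a \<in> H" "y = mul a x" by blast
          let ?S = "{s \<in> A. mul s x = x}"
          have AX: "s \<in> X" if "s \<in> A" for s using A(1) that by blast
          have "subgroup ?S ?G"
          proof (rule G.subgroupI)
            have "e \<in> ?S" using ex HA[OF eH] by simp
            then show "?S \<noteq> {}" by blast
            show "inv\<^bsub>?G\<^esub> s \<in> ?S" if "s \<in> ?S" for s
            proof -
              have s: "s \<in> carrier ?G" "mul s x = x" using that by auto
              have "mul (inv\<^bsub>?G\<^esub> s) x = mul (inv\<^bsub>?G\<^esub> s) (mul s x)" using s by simp
              also have "\<dots> = mul (mul (inv\<^bsub>?G\<^esub> s) s) x"
                using AX G.inv_closed[OF s(1)] s(1) xy(1) by (intro mul_assoc[symmetric]) auto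
              also have "mul (inv\<^bsub>?G\<^esub> s) s = e" using G.l_inv[OF s(1)] by simp
              finally show ?thesis using ex G.inv_closed[OF s(1)] by simp
            qed
            show "s \<otimes>\<^bsub>?G\<^esub> t \<in> ?S" if "s \<in> ?S" "t \<in> ?S" for s t
              using that AX xy(1) G.m_closed[of s t] by (simp add: mul_assoc)
            show "?S \<subseteq> carrier ?G" by simp
          qed
          moreover have "a \<in> H - ?S" using a xy(3) by auto
          ultimately obtain \<psi> where \<psi>: "D \<psi>" "\<forall>s\<in>?S \<inter> H. \<psi> s = 1" "\<psi> a \<noteq> 1"
            using separate unfolding D_def by blast
          have "triv \<psi> x" using \<psi>(1,2) HA ex by (auto simp: triv_def)
          moreover have "\<psi> b \<noteq> 1" if "b \<in> H" "y = mul b x" for b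
            using triv_unique[OF \<open>triv \<psi> x\<close> xy(1) that(1) a(1)] that(2) a(2) \<psi>(3) by simp
          ultimately show ?thesis by blast
        next
          case False
          then show ?thesis using triv_const by blast
        qed
        then obtain \<psi> where "triv \<psi> x" "\<forall>a\<in>H. y = mul a x \<longrightarrow> \<psi> a \<noteq> 1" by blast
        then show ?thesis using core_sep[OF P 3(1), of \<psi>] ex by simp
      qed
    qed
    show q: "(e, 1) \<in> P" by (simp add: P_def)
    have core_q: "core (e, 1)" by (simp add: core_def)
    have He: "mul a e = a" if "a \<in> H" for a using comm[OF eH, of a] that by simp
    have triv_q: "triv \<psi> e" if "D \<psi>" for \<psi>
      using that D_one[OF that] He by (simp add: triv_def)
    show "\<exists>B\<in>\<S>. (e, 1) \<in> B \<and> (x, 0) \<notin> B" if x: "x \<in> X" for x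
    proof -
      have P: "(x, 0) \<in> P" using x by (simp add: P_def)
      show ?thesis
      proof (cases "core (x, 0)")
        case False
        then show ?thesis using isolated_sep[OF q P] by simp
      next
        case True
        then have ex: "mul e x = x" by (simp add: core_def)
        show ?thesis
        proof (cases "x \<in> H")
          case False
          then show ?thesis
            by (intro core_sep[OF q P core_q, of "\<lambda>_. 1"] triv_const) (simp add: ex He)
        next
          case True
          \<comment> \<open>The bound on the real parts passes to the limit, so this character is 1
            at \<open>x\<close> but not at \<open>\<eta>\<close>.\<close>
          then obtain \<psi> where \<psi>: "D \<psi>" "\<psi> x = 1" "\<forall>\<^sub>F i in sequentially. Re (\<psi> (h i)) \<le> 0"
            using escape unfolding D_def by blast
          have "\<forall>\<^sub>F i in F. Re (\<psi> (h i)) \<le> 0" using \<psi>(3) F(1) by (rule filter_leD[rotated])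
          then have "Re (\<eta> \<psi>) \<le> 0"
            using tendsto_upperbound[OF tendsto_Re[OF \<eta>(2)[OF \<psi>(1)]]] F(2) by blast
          then have "\<eta> \<psi> \<noteq> 1" by auto
          then show ?thesis
            using triv_q[OF \<psi>(1)] \<psi>(2) by (intro core_sep[OF q P core_q, of \<psi>]) (simp_all add: ex He)
        qed
      qed
    qed
    show "\<exists>x\<in>X. \<forall>B\<in>\<F>. (x, 0) \<in> B"
      if \<F>: "finite \<F>" "\<F> \<subseteq> \<S>" "\<And>B. B \<in> \<F> \<Longrightarrow> (e, 1) \<in> B" for \<F>
    proof -
      have "\<forall>\<^sub>F i in F. \<forall>B\<in>\<F>. (h i, 0) \<in> B"
      proof (rule eventually_ball_finite[OF \<F>(1)], intro ballI)
        fix B assume B: "B \<in> \<F>"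
        then have "B \<in> \<S>" using \<F>(2) by blast
        then obtain \<psi> r where \<psi>: "triv \<psi> (fst (e, 1::nat))" "r > 0" "nb (e, 1) \<psi> r \<subseteq> B \<or> nb (e, 1) \<psi> r \<inter> B = {}"
          using q unfolding \<S>_def by blast
        note D = triv_D[OF \<psi>(1)]
        have sub: "nb (e, 1) \<psi> r \<subseteq> B" using \<psi>(3) nb_self[OF q D \<psi>(2)] \<F>(3)[OF B] by blast
        have "\<forall>\<^sub>F i in F. dist (\<psi> (h i)) (\<eta> \<psi>) < r"
          using \<eta>(2)[OF D] \<psi>(2) by (rule tendstoD)
        then show "\<forall>\<^sub>F i in F. (h i, 0) \<in> B"
        proof (rule eventually_mono)
          fix i assume i: "dist (\<psi> (h i)) (\<eta> \<psi>) < r"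
          have "rel \<psi> (e, 1) r (h i, 0)"
            unfolding rel_def using i h[of i] comm[OF eH, of "h i"]
            by (intro bexI[of _ "h i"]) (auto simp: dist_norm)
          then have "(h i, 0) \<in> nb (e, 1) \<psi> r"
            using core_q h[of i] by (simp add: nb_def core_def P_def)
          then show "(h i, 0) \<in> B" using sub by blast
        qed
      qed
      then obtain i where "\<forall>B\<in>\<F>. (h i, 0) \<in> B"
        using eventually_happens'[OF F(2)] by blast
      then show ?thesis using h by (intro bexI[of _ "h i"]) auto
    qed
  qed
qed

end

section \<open>Nonsingular commutative semigroups\<close>

text \<open>Greedy choice yields nested finite sets of every cardinality. \<open>R\<close> is
  demanded in both orders because \<open>pairwise\<close> ranges over ordered pairs of distinct
  elements; conditions on the diagonal go into \<open>U\<close>.\<close>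

lemma infinite_pairwise:
  assumes extend: "\<And>S. \<lbrakk>finite S; S \<subseteq> U\<rbrakk> \<Longrightarrow> \<exists>u\<in>U - S. \<forall>a\<in>S. R a u \<and> R u a"
  shows "\<exists>B\<subseteq>U. infinite B \<and> pairwise R B"
proof -
  have "\<exists>f. \<forall>n::nat. (finite (f n) \<and> card (f n) = n \<and> f n \<subseteq> U \<and> pairwise R (f n)) \<and> f n \<subseteq> f (Suc n)"
  proof (rule dependent_nat_choice)
    show "\<exists>S. finite S \<and> card S = 0 \<and> S \<subseteq> U \<and> pairwise R S"
      by (intro exI[of _ "{}"]) simp
    fix S n assume S: "finite S \<and> card S = n \<and> S \<subseteq> U \<and> pairwise R S"
    then obtain u where "u \<in> U - S" "\<forall>a\<in>S. R a u \<and> R u a" using extend[of S] by blast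
    then show "\<exists>S'. (finite S' \<and> card S' = Suc n \<and> S' \<subseteq> U \<and> pairwise R S') \<and> S \<subseteq> S'"
      using S by (intro exI[of _ "insert u S"]) (auto simp: pairwise_insert)
  qed
  then obtain f where f: "\<And>n::nat. finite (f n)" "\<And>n. card (f n) = n" "\<And>n. f n \<subseteq> U"
    "\<And>n. pairwise R (f n)" "\<And>n. f n \<subseteq> f (Suc n)" by metis
  have mono: "f i \<subseteq> f j" if "i \<le> j" for i j
    using f(5) that by (rule lift_Suc_mono_le)
  have "infinite (\<Union>n. f n)"
  proof
    assume fin: "finite (\<Union>n. f n)"
    have "card (f (Suc (card (\<Union>n. f n)))) \<le> card (\<Union>n. f n)"
      by (rule card_mono[OF fin]) blast
    then show False using f(2) by simp
  qed
  moreover have "pairwise R (\<Union>n. f n)"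
  proof (rule pairwiseI)
    fix a b assume "a \<in> (\<Union>n. f n)" "b \<in> (\<Union>n. f n)" "a \<noteq> b"
    then obtain i j where ij: "a \<in> f i" "b \<in> f j" by blast
    then have "a \<in> f (max i j)" "b \<in> f (max i j)"
      using mono[of i "max i j"] mono[of j "max i j"] by auto
    then show "R a b" using f(4)[of "max i j"] \<open>a \<noteq> b\<close> by (meson pairwiseD)
  qed
  ultimately show ?thesis using f(3) by (intro exI[of _ "\<Union>n. f n"]) blast
qed

text \<open>A repetition at \<open>s < t\<close> up to the first hit \<open>N\<close> would let the
  orbit reach \<open>E\<close> already at step \<open>N - (t - s)\<close>.\<close>

lemma inj_on_funpow_before_hitting:
  fixes T :: "'a \<Rightarrow> 'a"
  assumes "(T ^^ n) w \<in> E"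
  shows "inj_on (\<lambda>i. (T ^^ i) w) {..LEAST n. (T ^^ n) w \<in> E}"
proof -
  define N where "N = (LEAST n. (T ^^ n) w \<in> E)"
  have N: "(T ^^ N) w \<in> E" unfolding N_def using assms by (rule LeastI)
  have False if st: "s < t" "t \<le> N" "(T ^^ s) w = (T ^^ t) w" for s t
  proof -
    have "(T ^^ ((N - t) + s)) w = (T ^^ (N - t)) ((T ^^ s) w)"
      by (simp only: funpow_add comp_apply)
    also have "\<dots> = (T ^^ ((N - t) + t)) w"
      unfolding st(3) by (simp only: funpow_add comp_apply)
    finally have "(T ^^ ((N - t) + s)) w \<in> E" using N st(2) by simp
    then have "N \<le> (N - t) + s" unfolding N_def by (rule Least_le)
    then show False using st by simp
  qed
  then have "i = j" if "i \<le> N" "j \<le> N" "(T ^^ i) w = (T ^^ j) w" for i j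
    using that by (metis nat_neq_iff)
  then show ?thesis unfolding N_def[symmetric] by (intro inj_onI) simp
qed

locale nonsingular_comm_sgrp =
  fixes Z :: "'a set" and mul :: "'a \<Rightarrow> 'a \<Rightarrow> 'a"
  assumes closed [simp]: "x \<in> Z \<Longrightarrow> y \<in> Z \<Longrightarrow> mul x y \<in> Z"
    and assoc: "x \<in> Z \<Longrightarrow> y \<in> Z \<Longrightarrow> z \<in> Z \<Longrightarrow> mul (mul x y) z = mul x (mul y z)"
    and comm: "x \<in> Z \<Longrightarrow> y \<in> Z \<Longrightarrow> mul x y = mul y x"
    and nonsingular: "\<lbrakk>A \<subseteq> Z; \<And>a b. \<lbrakk>a \<in> A; b \<in> A\<rbrakk> \<Longrightarrow> mul a b = s\<rbrakk> \<Longrightarrow> finite A"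
begin

lemma lcomm: "x \<in> Z \<Longrightarrow> y \<in> Z \<Longrightarrow> z \<in> Z \<Longrightarrow> mul x (mul y z) = mul y (mul x z)"
  by (metis assoc comm)

text \<open>Let \<open>m\<close> be least with \<open>f^m(Z)\<close> finite, suppose
  \<open>m \<ge> 2\<close> and put \<open>k = m - 1\<close>. Then \<open>B = f^k(Z)\<close> is
  infinite, but \<open>f^k(B) = f^(k-1)(f^m(Z))\<close> is finite. For \<open>b = f^k(u)\<close> the
  product \<open>bb'\<close> equals \<open>f^k(b')u\<close>, so it depends on \<open>b'\<close> only
  through \<open>f^k(b')\<close>. An infinite fibre of \<open>f^k\<close> in \<open>B\<close>
  therefore has a constant product.\<close>

lemma finite_image_of_nilpotent:
  assumes f: "\<And>z. z \<in> Z \<Longrightarrow> f z \<in> Z"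
    and f_mul: "\<And>u v. \<lbrakk>u \<in> Z; v \<in> Z\<rbrakk> \<Longrightarrow> f (mul u v) = mul (f u) v"
    and fin: "finite ((f ^^ n) ` Z)"
  shows "finite (f ` Z)"
proof (rule ccontr)
  assume inf: "infinite (f ` Z)"
  have fk: "(f ^^ k) z \<in> Z" if "z \<in> Z" for k z
    using that f by (induction k) auto
  have fk_mul: "(f ^^ k) (mul u v) = mul ((f ^^ k) u) v" if "u \<in> Z" "v \<in> Z" for k u v
    using that f_mul fk by (induction k) auto
  define m where "m = (LEAST m. finite ((f ^^ m) ` Z))"
  have m: "finite ((f ^^ m) ` Z)" unfolding m_def using fin by (rule LeastI)
  have m_least: "infinite ((f ^^ k) ` Z)" if "k < m" for k
    using not_less_Least[of k] that unfolding m_def by blast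
  have "m \<noteq> 0" "m \<noteq> 1" using m inf by (auto intro: ccontr)
  define k where "k = m - 1"
  have k: "m = Suc k" "k \<ge> 1" using \<open>m \<noteq> 0\<close> \<open>m \<noteq> 1\<close> by (auto simp: k_def)
  define B where "B = (f ^^ k) ` Z"
  have "infinite B" unfolding B_def using m_least k by simp
  have "(f ^^ k) ` B = (f ^^ (k - 1)) ` (f ^^ m) ` Z"
  proof -
    have "k + k = (k - 1) + m" using k by simp
    then have "(f ^^ k) ((f ^^ k) z) = (f ^^ (k - 1)) ((f ^^ m) z)" for z
      by (metis comp_apply funpow_add)
    then show ?thesis by (simp add: B_def image_image)
  qed
  then have "finite ((f ^^ k) ` B)" using m by simp
  from pigeonhole_infinite[OF \<open>infinite B\<close> this]
  obtain b0 where b0: "b0 \<in> B" and inf_B: "infinite {b \<in> B. (f ^^ k) b = (f ^^ k) b0}" by blast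
  let ?B = "{b \<in> B. (f ^^ k) b = (f ^^ k) b0}"
  have BZ: "b \<in> Z" if "b \<in> B" for b using that fk by (auto simp: B_def)
  have left: "mul b b' = mul b b0" if b: "b \<in> ?B" and b': "b' \<in> ?B" for b b'
  proof -
    obtain u where u: "u \<in> Z" "b = (f ^^ k) u" using b by (auto simp: B_def)
    have "mul b w = mul ((f ^^ k) w) u" if "w \<in> Z" for w
      using fk_mul[OF u(1) that] fk_mul[OF that u(1)] comm[OF u(1) that] u(2) by simp
    from this[of b'] this[of b0] show ?thesis using b' b0 BZ by simp
  qed
  have "finite ?B"
  proof (rule nonsingular)
    show "?B \<subseteq> Z" using BZ by blast
    show "mul a b = mul b0 b0" if "a \<in> ?B" "b \<in> ?B" for a b
      using left[OF that] left[of b0 a] comm[of a b0] that b0 BZ by simp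
  qed
  then show False using inf_B by blast
qed

end

section \<open>Powers entering a finite ideal, and bounded exponents\<close>

locale finite_kernel_sgrp = nonsingular_comm_sgrp +
  fixes e
  assumes e [simp]: "e \<in> Z" and idem [simp]: "mul e e = e"
    and finite_eZ: "finite (mul e ` Z)"
begin

abbreviation "E \<equiv> mul e ` Z"

lemma E_absorb:
  assumes "x \<in> E" "z \<in> Z"
  shows "mul x z \<in> E" "mul z x \<in> E"
proof -
  obtain w where w: "w \<in> Z" "x = mul e w" using assms(1) by auto
  then have "mul x z = mul e (mul w z)" using assms(2) by (simp add: assoc)
  then show "mul x z \<in> E" using w assms(2) by simp
  then show "mul z x \<in> E" using comm[of x z] w assms(2) by simp
qed

lemma e_E: "x \<in> E \<Longrightarrow> mul e x = x"
  by (auto simp: assoc[symmetric])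

lemma funpow_mem: "z \<in> Z \<Longrightarrow> w \<in> Z \<Longrightarrow> (mul z ^^ n) w \<in> Z"
  by (induction n) auto

lemma funpow_mul: "z \<in> Z \<Longrightarrow> w \<in> Z \<Longrightarrow> v \<in> Z \<Longrightarrow> (mul z ^^ n) (mul w v) = mul ((mul z ^^ n) w) v"
  by (induction n) (auto simp: assoc funpow_mem)

lemma funpow_E_mono:
  assumes "(mul z ^^ n) w \<in> E" "n \<le> k" "z \<in> Z"
  shows "(mul z ^^ k) w \<in> E"
proof -
  have "(mul z ^^ (d + n)) w \<in> E" for d
    using assms E_absorb(2) by (induction d) auto
  from this[of "k - n"] show ?thesis using assms(2) by simp
qed

text \<open>Iterated multiplication by \<open>a\<close> ends in the finite ideal \<open>E\<close>,
  so \<open>finite_image_of_nilpotent\<close> applies to \<open>mul a\<close>. The iteration starts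
  at \<open>a\<close>, so \<open>(mul a ^^ n) a\<close> is the power \<open>a^(n+1)\<close>.\<close>

lemma finite_mul_image:
  assumes a: "a \<in> Z" "(mul a ^^ n) a \<in> E"
  shows "finite (mul a ` Z)"
proof (rule finite_image_of_nilpotent)
  have "(mul a ^^ Suc n) z \<in> E" if "z \<in> Z" for z
  proof -
    have "(mul a ^^ Suc n) z = mul ((mul a ^^ n) a) z"
      using funpow_mul[OF a(1) a(1) that] by (simp only: funpow_Suc_right comp_apply)
    then show ?thesis using E_absorb(1)[OF a(2) that] by simp
  qed
  then show "finite ((mul a ^^ Suc n) ` Z)"
    by (intro finite_subset[OF _ finite_eZ]) blast
qed (use a assoc in auto)

text \<open>If the exponents were unbounded, powers taken just before they enter \<open>E\<close>
  would give an infinite set with all products in \<open>E\<close>. Fixing \<open>eb\<close> on an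
  infinite subset makes these products constant.\<close>

lemma bounded:
  assumes periodic: "\<And>z. z \<in> Z \<Longrightarrow> \<exists>n. (mul z ^^ n) z \<in> E"
  shows "\<exists>m. \<forall>z\<in>Z. (mul z ^^ m) z \<in> E"
proof (rule ccontr)
  assume "\<nexists>m. \<forall>z\<in>Z. (mul z ^^ m) z \<in> E"
  then have unbounded: "\<exists>z\<in>Z. (mul z ^^ m) z \<notin> E" for m by blast
  have fin: "finite (mul a ` Z)" if "a \<in> Z" for a
    using periodic[OF that] finite_mul_image[OF that] by blast
  let ?U = "{u \<in> Z. mul u u \<in> E}"
  have "\<exists>B\<subseteq>?U. infinite B \<and> pairwise (\<lambda>a u. mul a u \<in> E) B"
  proof (rule infinite_pairwise)
    fix S assume S: "finite S" "S \<subseteq> ?U"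
    \<comment> \<open>\<open>r\<close> bounds the size of \<open>aZ\<close> for all
      \<open>a \<in> S\<close>. The margin \<open>r + 2 * card S + 2\<close> below leaves room for
      \<open>card S + 1\<close> candidates \<open>i\<close> just before \<open>N\<close>, one of
      which avoids \<open>S\<close>, while keeping \<open>i \<ge> r\<close> and
      \<open>2i + 1 \<ge> N\<close>.\<close>
    define r where "r = (\<Sum>a\<in>S. card (mul a ` Z))"
    have r: "card (mul a ` Z) \<le> r" if "a \<in> S" for a
      unfolding r_def using S(1) that by (intro member_le_sum) auto
    obtain z where z: "z \<in> Z" "(mul z ^^ (r + 2 * card S + 2)) z \<notin> E"
      using unbounded by blast
    obtain n where n: "(mul z ^^ n) z \<in> E" using periodic[OF z(1)] by blast
    define N where "N = (LEAST n. (mul z ^^ n) z \<in> E)"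
    have N: "(mul z ^^ N) z \<in> E" unfolding N_def using n by (rule LeastI)
    then have large: "N > r + 2 * card S + 2"
      using funpow_E_mono[OF N _ z(1)] z(2) by (meson not_le)
    have "inj_on (\<lambda>i. (mul z ^^ i) z) {N - 1 - card S..<N}"
      using inj_on_funpow_before_hitting[OF n] unfolding N_def[symmetric]
      by (rule inj_on_subset) auto
    then have "card ((\<lambda>i. (mul z ^^ i) z) ` {N - 1 - card S..<N}) = Suc (card S)"
      using large by (simp add: card_image)
    then have "\<not> (\<lambda>i. (mul z ^^ i) z) ` {N - 1 - card S..<N} \<subseteq> S"
      using card_mono[OF S(1), of "(\<lambda>i. (mul z ^^ i) z) ` {N - 1 - card S..<N}"] by linarith
    then obtain i where i: "N - 1 - card S \<le> i" "i < N" "(mul z ^^ i) z \<notin> S"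
      unfolding image_subset_iff Ball_def atLeastLessThan_iff by blast
    define u where "u = (mul z ^^ i) z"
    have u: "u \<in> Z" unfolding u_def using funpow_mem z by blast
    have "mul u u \<in> E"
    proof -
      have "mul u u = (mul z ^^ i) (mul z u)"
        using funpow_mul[OF z(1) z(1) u] by (simp add: u_def)
      also have "\<dots> = (mul z ^^ (i + Suc i)) z"
        unfolding u_def by (simp only: funpow_add comp_apply funpow.simps)
      finally show ?thesis
        using funpow_E_mono[OF N _ z(1), of "i + Suc i"] large i by simp
    qed
    moreover have "mul a u \<in> E" if a: "a \<in> S" for a
    proof -
      have aZ: "a \<in> Z" using a S(2) by blast
      have pow: "(mul z ^^ n) (mul a z) = mul a ((mul z ^^ n) z)" for n
        using funpow_mul[OF z(1) z(1) aZ] comm[OF aZ z(1)] comm[OF aZ funpow_mem[OF z(1) z(1)]] by simp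
      then have hit: "(mul z ^^ n) (mul a z) \<in> E" using E_absorb(2)[OF n aZ] by simp
      \<comment> \<open>The elements \<open>a z^(n+1)\<close> lie in \<open>aZ\<close> and do not
        repeat before entering \<open>E\<close>, so they enter it in fewer than \<open>r\<close>
        steps, hence by step \<open>i\<close>.\<close>
      define M where "M = (LEAST n. (mul z ^^ n) (mul a z) \<in> E)"
      have M: "(mul z ^^ M) (mul a z) \<in> E" unfolding M_def using hit by (rule LeastI)
      have "card {..M} \<le> card (mul a ` Z)"
      proof (rule card_inj_on_le)
        show "inj_on (\<lambda>n. (mul z ^^ n) (mul a z)) {..M}"
          unfolding M_def by (rule inj_on_funpow_before_hitting[OF hit])
        show "(\<lambda>n. (mul z ^^ n) (mul a z)) ` {..M} \<subseteq> mul a ` Z"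
          unfolding pow using funpow_mem z(1) by blast
        show "finite (mul a ` Z)" by (rule fin[OF aZ])
      qed
      then have "M \<le> i" using r[OF a] i(1) large by simp
      from funpow_E_mono[OF M this z(1)] show ?thesis by (simp only: pow u_def)
    qed
    ultimately show "\<exists>u\<in>?U - S. \<forall>a\<in>S. mul a u \<in> E \<and> mul u a \<in> E"
    proof (intro bexI[of _ u] ballI conjI)
      assume *: "mul u u \<in> E" "\<And>a. a \<in> S \<Longrightarrow> mul a u \<in> E"
      show "u \<in> ?U - S" using * u i(3) by (simp add: u_def)
      fix a assume "a \<in> S"
      with S(2) have "a \<in> Z" by blast
      then show "mul a u \<in> E" "mul u a \<in> E" using *(2)[OF \<open>a \<in> S\<close>] comm[OF u] by simp_all
    qed
  qed
  then obtain B where B: "B \<subseteq> ?U" "infinite B" "pairwise (\<lambda>a u. mul a u \<in> E) B" by blast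
  have BE: "mul a b \<in> E" if "a \<in> B" "b \<in> B" for a b
    using that B(1,3) by (cases "a = b") (auto dest: pairwiseD)
  have "finite (mul e ` B)" using B(1) by (intro finite_subset[OF _ finite_eZ]) blast
  from pigeonhole_infinite[OF B(2) this]
  obtain b0 where b0: "infinite {b \<in> B. mul e b = mul e b0}" by blast
  let ?B = "{b \<in> B. mul e b = mul e b0}"
  have "finite ?B"
  proof (rule nonsingular)
    show "?B \<subseteq> Z" using B(1) by blast
    show "mul a b = mul (mul e b0) (mul e b0)" if ab: "a \<in> ?B" "b \<in> ?B" for a b
    proof -
      have Z: "a \<in> Z" "b \<in> Z" using ab B(1) by auto
      have "mul a b \<in> E" using BE ab by blast
      then have "mul a b = mul e (mul a b)" by (rule e_E[symmetric])
      also have "\<dots> = mul e (mul e (mul a b))" using Z by (simp add: assoc[symmetric])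
      also have "\<dots> = mul (mul e a) (mul e b)" using Z lcomm[of e a b] by (simp add: assoc)
      finally show ?thesis using ab by simp
    qed
  qed
  then show False using b0 by blast
qed

end

section \<open>Limits in \<open>T\<^sub>1\<close> semigroups\<close>

text \<open>\<open>A - {p}\<close> is finite, hence closed in a \<open>T\<^sub>1\<close> space, and
  misses \<open>p\<close>, so \<open>g\<close> eventually avoids it. This replaces uniqueness of
  limits.\<close>

lemma limitin_t1_finite:
  assumes lim: "limitin S g p F" and "t1_space S" and "F \<noteq> bot"
    and A: "finite A" "eventually (\<lambda>u. g u \<in> A) F"
  shows "p \<in> A" "eventually (\<lambda>u. g u = p) F"
proof -
  have "closedin S ((A - {p}) \<inter> topspace S)"
    using \<open>t1_space S\<close> A(1) unfolding t1_space_closedin_finite by simp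
  then have "openin S (topspace S - (A - {p}) \<inter> topspace S)"
    by blast
  moreover have "p \<in> topspace S - (A - {p}) \<inter> topspace S"
    using limitin_topspace[OF lim] by blast
  ultimately have "eventually (\<lambda>u. g u \<in> topspace S - (A - {p}) \<inter> topspace S) F"
    by (rule limitinD[OF lim])
  from eventually_conj[OF this A(2)] have ev: "eventually (\<lambda>u. g u = p \<and> g u \<in> A) F"
    by (rule eventually_mono) blast
  then show "eventually (\<lambda>u. g u = p) F"
    by (rule eventually_mono) blast
  show "p \<in> A" using eventually_happens'[OF \<open>F \<noteq> bot\<close> ev] by auto
qed

lemma limitin_mul:
  assumes "topological_semigroup S m" "limitin S f p F" "limitin S g q F"
  shows "limitin S (\<lambda>u. m (f u) (g u)) (m p q) F"
proof -
  have "limitin (prod_topology S S) (\<lambda>u. (f u, g u)) (p, q) F"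
    using assms(2,3) by (simp add: limitin_pairwise comp_def)
  from continuous_map_limit[OF _ this, of S "\<lambda>(x, y). m x y"] show ?thesis
    using assms(1) by (simp add: topological_semigroup_def comp_def)
qed

context finite_kernel_sgrp
begin

context
  fixes S :: "'b topology" and m and h :: "'a \<Rightarrow> 'b"
  assumes S: "topological_semigroup S m" and t1: "t1_space S"
    and hom: "semigroup_hom_on Z mul (topspace S) m h" and inj: "inj_on h Z"
    and bounded: "\<exists>n. \<forall>z\<in>Z. (mul z ^^ n) z \<in> E"
begin

lemma hom_mem: "z \<in> Z \<Longrightarrow> h z \<in> topspace S"
  using hom by (auto simp: semigroup_hom_on_def)

lemma hom_mul: "x \<in> Z \<Longrightarrow> y \<in> Z \<Longrightarrow> h (mul x y) = m (h x) (h y)"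
  using hom by (simp add: semigroup_hom_on_def)

lemma m_assoc: "x \<in> topspace S \<Longrightarrow> y \<in> topspace S \<Longrightarrow> z \<in> topspace S \<Longrightarrow> m (m x y) z = m x (m y z)"
  using S by (simp add: topological_semigroup_def semigroup_on_def)

text \<open>
  Multiplication by the limit \<open>y\<close> maps \<open>Z\<close> into \<open>Z\<close>, with finite image; so \<open>F\<close>-almost all \<open>u\<close>
  satisfy \<open>yu = y\<^sup>2 = u\<^sup>2\<close>, and any such \<open>u\<close> satisfies \<open>vu = yu\<close> for almost all \<open>v\<close>.
\<close>

lemma finite_squares_no_limit:
  assumes F_Z: "eventually (\<lambda>u. u \<in> Z) F" and lim: "limitin S h y F"
    and free: "\<And>A. finite A \<Longrightarrow> \<not> eventually (\<lambda>u. u \<in> A) F"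
    and squares: "finite A" "eventually (\<lambda>u. mul u u \<in> A) F"
  shows False
proof -
  have F: "F \<noteq> bot" using free[of "{}"] by (auto simp: trivial_limit_def)
  obtain n where n: "\<And>z. z \<in> Z \<Longrightarrow> (mul z ^^ n) z \<in> E" using bounded by blast
  have y: "y \<in> topspace S" by (rule limitin_topspace[OF lim])
  have ev_inj: "eventually (\<lambda>u. g u = g' u) F"
    if "eventually (\<lambda>u. g u \<in> Z) F" "eventually (\<lambda>u. g' u \<in> Z) F" "eventually (\<lambda>u. h (g u) = h (g' u)) F" for g g'
    using that by eventually_elim (use inj in \<open>auto dest: inj_onD\<close>)
  \<comment> \<open>For fixed \<open>a\<close> the products \<open>ua\<close> range over the finite
    set \<open>aZ\<close> and their images converge to \<open>y h(a)\<close>, so almost all of them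
    equal one element. Taking it as \<open>f a\<close> transports multiplication by \<open>y\<close>
    to \<open>Z\<close>.\<close>
  have "\<exists>b\<in>Z. h b = m y (h a) \<and> eventually (\<lambda>u. mul u a = b) F" if a: "a \<in> Z" for a
  proof -
    have ev: "eventually (\<lambda>u. h (mul u a) = m (h u) (h a)) F"
      using F_Z by eventually_elim (use a hom_mul in simp)
    have "limitin S (\<lambda>u. m (h u) (h a)) (m y (h a)) F"
      using limitin_mul[OF S lim, of "\<lambda>_. h a" "h a"] hom_mem[OF a] by simp
    then have lim_a: "limitin S (\<lambda>u. h (mul u a)) (m y (h a)) F"
      by (rule limitin_transform_eventually[rotated]) (use ev in eventually_elim, simp)
    have fin: "finite (h ` mul a ` Z)" using finite_mul_image[OF a n[OF a]] by simp
    have "eventually (\<lambda>u. h (mul u a) \<in> h ` mul a ` Z) F"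
      using F_Z by eventually_elim (use a comm in auto)
    note t = limitin_t1_finite[OF lim_a t1 F fin this]
    from t(1) obtain x where x: "x \<in> Z" "m y (h a) = h (mul a x)" by blast
    define b where "b = mul a x"
    have b: "b \<in> Z" "h b = m y (h a)" using x a by (simp_all add: b_def)
    have "eventually (\<lambda>u. mul u a = b) F"
    proof (rule ev_inj)
      show "eventually (\<lambda>u. mul u a \<in> Z) F" using F_Z by eventually_elim (use a in simp)
    qed (use b t(2) in auto)
    then show ?thesis using b by blast
  qed
  then obtain f where f: "\<And>a. a \<in> Z \<Longrightarrow> f a \<in> Z" "\<And>a. a \<in> Z \<Longrightarrow> h (f a) = m y (h a)"
    "\<And>a. a \<in> Z \<Longrightarrow> eventually (\<lambda>u. mul u a = f a) F"
    by metis
  have f_mul: "f (mul a b) = mul (f a) b" if "a \<in> Z" "b \<in> Z" for a b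
  proof -
    have "h (f (mul a b)) = h (mul (f a) b)"
      using that f y by (simp add: hom_mul m_assoc hom_mem)
    then show ?thesis by (rule inj_onD[OF inj]) (use that f in simp_all)
  qed
  have ev_pow: "eventually (\<lambda>u. (mul u ^^ k) a = (f ^^ k) a) F \<and> (f ^^ k) a \<in> Z" if a: "a \<in> Z" for a k
  proof (induction k)
    case (Suc k)
    then have ev: "eventually (\<lambda>u. (mul u ^^ k) a = (f ^^ k) a) F" and "(f ^^ k) a \<in> Z" by auto
    from ev f(3)[OF \<open>(f ^^ k) a \<in> Z\<close>]
    have "eventually (\<lambda>u. mul u ((mul u ^^ k) a) = f ((f ^^ k) a)) F"
      by eventually_elim simp
    then show ?case using f(1) \<open>(f ^^ k) a \<in> Z\<close> by simp
  qed (use a in simp)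
  \<comment> \<open>Almost every \<open>u\<close> satisfies \<open>u^(n+1) a = f^(n+1)(a)\<close>,
    and the left side lies in \<open>E\<close>; the uniform exponent \<open>n\<close> is essential,
    as \<open>u\<close> varies.\<close>
  have "(f ^^ Suc n) a \<in> E" if a: "a \<in> Z" for a
  proof -
    have "eventually (\<lambda>u. (mul u ^^ Suc n) a \<in> E) F"
      using F_Z
    proof eventually_elim
      case (elim u)
      have "(mul u ^^ Suc n) a = mul ((mul u ^^ n) u) a"
        using funpow_mul[OF elim elim a] by (simp only: funpow_Suc_right comp_apply)
      then show ?case using E_absorb(1)[OF n[OF elim] a] by simp
    qed
    with conjunct1[OF ev_pow[OF a, of "Suc n"]] have "eventually (\<lambda>u. (f ^^ Suc n) a \<in> E) F"
      by eventually_elim metis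
    then show ?thesis using F by (simp add: eventually_const_iff)
  qed
  then have "finite ((f ^^ Suc n) ` Z)"
    by (intro finite_subset[OF _ finite_eZ]) blast
  from finite_image_of_nilpotent[OF f(1) f_mul this] have fin: "finite (h ` f ` Z)" by simp
  have ev_hf: "eventually (\<lambda>u. m y (h u) = h (f u)) F"
    using F_Z by eventually_elim (use f in simp)
  have "limitin S (\<lambda>u. m y (h u)) (m y y) F"
    using limitin_mul[OF S _ lim, of "\<lambda>_. y" y] y by simp
  from limitin_transform_eventually[OF ev_hf this]
  have lim_f: "limitin S (\<lambda>u. h (f u)) (m y y) F" .
  have "eventually (\<lambda>u. h (f u) \<in> h ` f ` Z) F"
    using F_Z by eventually_elim blast
  note t = limitin_t1_finite[OF lim_f t1 F fin this]
  from t(1) obtain x where x: "x \<in> Z" "m y y = h (f x)" by blast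
  define c where "c = f x"
  have c: "c \<in> Z" "h c = m y y" using x f(1) by (simp_all add: c_def)
  have ev_f: "eventually (\<lambda>u. f u = c) F"
  proof (rule ev_inj)
    show "eventually (\<lambda>u. f u \<in> Z) F" using F_Z by eventually_elim (use f in simp)
  qed (use c t(2) in auto)
  have ev_sq: "eventually (\<lambda>u. mul u u = c) F"
  proof (rule ev_inj)
    show "eventually (\<lambda>u. mul u u \<in> Z) F" using F_Z by eventually_elim simp
    have ev: "eventually (\<lambda>u. m (h u) (h u) = h (mul u u)) F"
      using F_Z by eventually_elim (simp add: hom_mul)
    have lim2: "limitin S (\<lambda>u. h (mul u u)) (m y y) F"
      using limitin_transform_eventually[OF ev limitin_mul[OF S lim lim]] .
    have "eventually (\<lambda>u. h (mul u u) \<in> h ` A) F"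
      using squares(2) by eventually_elim blast
    from limitin_t1_finite(2)[OF lim2 t1 F _ this] show "eventually (\<lambda>u. h (mul u u) = h c) F"
      using squares(1) c(2) by simp
  qed (use c in simp)
  let ?U = "{u \<in> Z. f u = c \<and> mul u u = c}"
  have ev_U: "eventually (\<lambda>u. u \<in> ?U) F"
    using F_Z ev_f ev_sq by eventually_elim simp
  \<comment> \<open>Against finitely many chosen \<open>a\<close>, almost all \<open>u\<close>
    satisfy \<open>ua = f a = c\<close>, and freeness of \<open>F\<close> provides one not yet
    chosen.\<close>
  have "\<exists>B\<subseteq>?U. infinite B \<and> pairwise (\<lambda>a u. mul a u = c) B"
  proof (rule infinite_pairwise)
    fix T assume T: "finite T" "T \<subseteq> ?U"
    have "eventually (\<lambda>u. \<forall>a\<in>T. mul u a = c) F"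
      by (rule eventually_ball_finite[OF T(1)]) (use T(2) f(3) in auto)
    then have ev: "eventually (\<lambda>u. u \<in> ?U \<and> (\<forall>a\<in>T. mul u a = c)) F"
      using ev_U by eventually_elim simp
    obtain u where u: "u \<in> ?U \<and> (\<forall>a\<in>T. mul u a = c)" "u \<notin> T"
      using free[OF T(1)] eventually_mono[OF ev, of "\<lambda>u. u \<in> T"] by blast
    then show "\<exists>u\<in>?U - T. \<forall>a\<in>T. mul a u = c \<and> mul u a = c"
    proof (intro bexI[of _ u] ballI conjI)
      fix a assume "a \<in> T"
      then have "a \<in> Z" "mul u a = c" using T(2) u(1) by auto
      then show "mul u a = c" "mul a u = c" using comm[of a u] u(1) by auto
    qed simp
  qed
  then obtain B where B: "B \<subseteq> ?U" "infinite B" "pairwise (\<lambda>a u. mul a u = c) B" by blast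
  have "finite B"
  proof (rule nonsingular)
    show "mul a b = c" if "a \<in> B" "b \<in> B" for a b
      using that B(1,3) by (cases "a = b") (auto dest: pairwiseD)
  qed (use B in blast)
  then show False using B(2) by blast
qed

text \<open>By bounded exponents, repeated squaring drives the trace of the neighbourhoods of
  \<open>y\<close> into the finite set \<open>E\<close>. Just before the filter first concentrates
  on a finite set it is still free while its squares are not, so
  \<open>finite_squares_no_limit\<close> applies with a power of \<open>y\<close> as the
  limit.\<close>

lemma closedin_image: "closedin S (h ` Z)"
proof (rule ccontr)
  assume "\<not> closedin S (h ` Z)"
  then have "S closure_of (h ` Z) \<noteq> h ` Z" by (simp add: closure_of_eq)
  moreover have "h ` Z \<subseteq> S closure_of (h ` Z)"
    using hom_mem by (intro closure_of_subset) auto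
  ultimately obtain y where y: "y \<in> S closure_of (h ` Z)" "y \<notin> h ` Z"
    by blast
  define sq where "sq z = mul z z" for z
  have sqZ: "(sq ^^ k) z \<in> Z" if "z \<in> Z" for k z
    using that by (induction k) (auto simp: sq_def)
  define F where "F = inf (filtercomap h (nhdsin S y)) (principal Z)"
  have yS: "y \<in> topspace S" using y(1) by (simp add: in_closure_of)
  have ev_F: "eventually P F \<longleftrightarrow> (\<exists>U. openin S U \<and> y \<in> U \<and> (\<forall>z\<in>Z. h z \<in> U \<longrightarrow> P z))" for P
  proof -
    have "eventually P F \<longleftrightarrow> (\<exists>Q. (\<exists>U. openin S U \<and> y \<in> U \<and> (\<forall>x\<in>U. Q x)) \<and> (\<forall>z. Q (h z) \<longrightarrow> z \<in> Z \<longrightarrow> P z))"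
      by (simp add: F_def eventually_inf_principal eventually_filtercomap eventually_nhdsin yS)
    also have "\<dots> \<longleftrightarrow> (\<exists>U. openin S U \<and> y \<in> U \<and> (\<forall>z\<in>Z. h z \<in> U \<longrightarrow> P z))"
    proof
      assume "\<exists>U. openin S U \<and> y \<in> U \<and> (\<forall>z\<in>Z. h z \<in> U \<longrightarrow> P z)"
      then obtain U where "openin S U" "y \<in> U" "\<forall>z\<in>Z. h z \<in> U \<longrightarrow> P z" by blast
      then show "\<exists>Q. (\<exists>U. openin S U \<and> y \<in> U \<and> (\<forall>x\<in>U. Q x)) \<and> (\<forall>z. Q (h z) \<longrightarrow> z \<in> Z \<longrightarrow> P z)"
        by (intro exI[of _ "\<lambda>x. x \<in> U"]) blast
    qed blast
    finally show ?thesis .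
  qed
  have free: "\<not> eventually (\<lambda>u. u \<in> A) F" if "finite A" for A
  proof
    assume "eventually (\<lambda>u. u \<in> A) F"
    then obtain U where U: "openin S U" "y \<in> U" "\<And>z. z \<in> Z \<Longrightarrow> h z \<in> U \<Longrightarrow> z \<in> A"
      unfolding ev_F by blast
    have "finite (h ` (A \<inter> Z))" "h ` (A \<inter> Z) \<subseteq> topspace S"
      using that hom_mem by (simp_all add: image_subset_iff)
    then have "closedin S (h ` (A \<inter> Z))"
      using t1 unfolding t1_space_closedin_finite by simp
    then have "openin S (U - h ` (A \<inter> Z))" using U(1) by (rule openin_diff[rotated])
    moreover have "y \<in> U - h ` (A \<inter> Z)" using U(2) y(2) by blast
    ultimately obtain z where "z \<in> Z" "h z \<in> U - h ` (A \<inter> Z)"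
      using y(1) unfolding in_closure_of by blast
    then show False using U(3) by blast
  qed
  define G where "G k = filtermap (sq ^^ k) F" for k
  have G_Z: "eventually (\<lambda>u. u \<in> Z) (G k)" for k
  proof -
    have "eventually (\<lambda>u. u \<in> Z) F" by (simp add: F_def eventually_inf_principal)
    then show ?thesis unfolding G_def eventually_filtermap by (rule eventually_mono) (rule sqZ)
  qed
  have G_Suc: "G (Suc k) = filtermap sq (G k)" for k
    by (simp add: G_def filtermap_filtermap comp_def)
  have G_lim: "\<exists>y. limitin S h y (G k)" for k
  proof (induction k)
    case 0
    have "limitin S h y F"
      unfolding limitin_def ev_F using yS by blast
    then show ?case by (auto simp: G_def id_def filtermap_ident)
  next
    case (Suc k)
    then obtain y where y: "limitin S h y (G k)" by blast
    have "eventually (\<lambda>u. m (h u) (h u) = h (sq u)) (G k)"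
      using G_Z by (rule eventually_mono) (simp add: sq_def hom_mul)
    from limitin_transform_eventually[OF this limitin_mul[OF S y y]]
    have "limitin S h (m y y) (G (Suc k))"
      by (simp add: G_Suc limitin_def eventually_filtermap)
    then show ?case by blast
  qed
  define Free where "Free k \<longleftrightarrow> (\<forall>A. finite A \<longrightarrow> \<not> eventually (\<lambda>u. u \<in> A) (G k))" for k
  have "Free 0" using free by (simp add: Free_def G_def id_def filtermap_ident)
  obtain n where n: "\<And>z. z \<in> Z \<Longrightarrow> (mul z ^^ n) z \<in> E" using bounded by blast
  \<comment> \<open>The exponent is \<open>2^k - 1\<close> because the iteration starts from
    \<open>z\<close> rather than from a unit.\<close>
  have sq_pow: "(sq ^^ k) z = (mul z ^^ (2 ^ k - 1)) z" if z: "z \<in> Z" for k z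
  proof (induction k)
    case (Suc k)
    define w where "w = (mul z ^^ (2 ^ k - 1)) z"
    have w: "w \<in> Z" unfolding w_def by (rule funpow_mem[OF z z])
    have "(sq ^^ Suc k) z = sq w" using Suc by (simp add: w_def)
    also have "\<dots> = mul w w" by (simp only: sq_def)
    also have "\<dots> = (mul z ^^ (2 ^ k - 1)) (mul z w)"
      using funpow_mul[OF z z w, of "2 ^ k - 1"] by (simp only: w_def)
    also have "\<dots> = (mul z ^^ ((2 ^ k - 1) + Suc (2 ^ k - 1))) z"
      unfolding w_def by (simp only: funpow_add comp_apply funpow.simps)
    also have "(2 ^ k - 1) + Suc (2 ^ k - 1) = (2 ^ Suc k - 1 :: nat)"
      by simp
    finally show ?case .
  qed simp
  have "n \<le> 2 ^ n - 1" by (metis less_exp Suc_leI Suc_le_mono Suc_pred' zero_less_numeral zero_less_power)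
  then have "(sq ^^ n) z \<in> E" if "z \<in> Z" for z
    unfolding sq_pow[OF that] using funpow_E_mono[OF n[OF that] _ that] by blast
  then have "eventually (\<lambda>u. u \<in> E) (G n)"
    unfolding G_def eventually_filtermap F_def eventually_inf_principal by simp
  then have "\<not> Free n" using finite_eZ by (auto simp: Free_def)
  define k where "k = (LEAST k. \<not> Free k)"
  have "\<not> Free k" unfolding k_def using \<open>\<not> Free n\<close> by (rule LeastI)
  then obtain l where l: "k = Suc l" using \<open>Free 0\<close> by (cases k) auto
  then have "Free l" using not_less_Least[of l "\<lambda>k. \<not> Free k"] unfolding k_def by auto
  obtain A where A: "finite A" "eventually (\<lambda>u. mul u u \<in> A) (G l)"
    using \<open>\<not> Free k\<close> unfolding Free_def l G_Suc eventually_filtermap sq_def by blast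
  obtain y' where "limitin S h y' (G l)" using G_lim by blast
  from finite_squares_no_limit[OF G_Z this _ A] \<open>Free l\<close> show False
    by (auto simp: Free_def)
qed

end

end

section \<open>The center of a unipotent semigroup\<close>

theorem corollary1p8:
  fixes \<C> :: "'a topsgp_class"
    and X :: "'a set"
    and mul :: "'a \<Rightarrow> 'a \<Rightarrow> 'a"
  assumes "TzS \<subseteq> \<C>" and "\<C> \<subseteq> T1S"
    and "semigroup_on X mul"
    and "unipotent_on X mul"
    and "injectively_closed_semigroup \<C> X mul"
  shows "injectively_closed_semigroup \<C> (center_on X mul) mul"
  unfolding injectively_closed_semigroup_def injectively_closed_def topspace_discrete_topology
proof (intro ballI, clarify)
  fix S m and h :: "'a \<Rightarrow> 'a"
  let ?Z = "center_on X mul"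
  assume "(S, m) \<in> \<C>" and h: "semigroup_hom_on ?Z mul (topspace S) m h" "inj_on h ?Z"
  then have S: "topological_semigroup S m" "t1_space S"
    using assms(2) by (auto simp: T1S_def)
  show "closedin S (h ` ?Z)"
  proof (cases "finite ?Z")
    case True
    then show ?thesis
      using S(2) h(1) unfolding t1_space_closedin_finite by (auto simp: semigroup_hom_on_def)
  next
    case False
    have ZX: "z \<in> X" if "z \<in> ?Z" for z using that by (simp add: center_on_def)
    have "infinite X" using False ZX by (meson finite_subset subsetI)
    then interpret injectively_closed_sgrp \<C> X mul
      by unfold_locales (use assms in auto)
    have central: "mul x z = mul z x" if "z \<in> ?Z" "x \<in> X" for x z
      using that by (simp add: center_on_def)
    have Z_closed: "mul x y \<in> ?Z" if "x \<in> ?Z" "y \<in> ?Z" for x y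
    proof -
      have "mul w (mul x y) = mul (mul x y) w" if w: "w \<in> X" for w
      proof -
        note X = ZX[OF \<open>x \<in> ?Z\<close>] ZX[OF \<open>y \<in> ?Z\<close>] w
        have "mul w (mul x y) = mul (mul w x) y"
          using X by (simp only: mul_assoc)
        also have "\<dots> = mul x (mul w y)"
          unfolding central[OF \<open>x \<in> ?Z\<close> w] using X by (simp only: mul_assoc)
        also have "\<dots> = mul (mul x y) w"
          unfolding central[OF \<open>y \<in> ?Z\<close> w] using X by (simp only: mul_assoc)
        finally show ?thesis .
      qed
      moreover have "mul x y \<in> X" using that by (intro mul_closed ZX)
      ultimately show ?thesis by (simp only: center_on_def mem_Collect_eq) simp
    qed
    obtain e where e: "e \<in> X" "mul e e = e" and e_unique: "\<And>x. \<lbrakk>x \<in> X; mul x x = x\<rbrakk> \<Longrightarrow> x = e"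
      using assms(4) unfolding unipotent_on_def by blast
    have pow_Z: "(mul z ^^ n) w \<in> ?Z" if "z \<in> ?Z" "w \<in> ?Z" for z w n
      using that Z_closed by (induction n) auto
    have pow_mul: "(mul z ^^ n) (mul w v) = mul ((mul z ^^ n) w) v" if "z \<in> ?Z" "w \<in> ?Z" "v \<in> ?Z" for z w v n
      using that pow_Z ZX by (induction n) (auto simp: mul_assoc)
    have periodic: "\<exists>n. (mul z ^^ n) z = e" if z: "z \<in> ?Z" for z
    proof -
      have "\<exists>i j. i < j \<and> (mul z ^^ i) z = (mul z ^^ j) z"
      proof (rule finite_orbit)
        show "mul z (mul x y) = mul x (mul z y)" if "x \<in> X" "y \<in> X" for x y
          using that z ZX central by (metis mul_assoc)
      qed (use z ZX in \<open>auto simp: mul_assoc\<close>)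
      then obtain i j where ij: "i < j" "(mul z ^^ i) z = (mul z ^^ j) z" by blast
      define d where "d = j - i"
      have d: "d > 0" "i + d = j" using ij by (auto simp: d_def)
      have period: "(mul z ^^ (l + d * q)) z = (mul z ^^ l) z" if l: "i \<le> l" for l q
      proof (induction q)
        case (Suc q)
        have "l + d * Suc q = (l - i + d * q) + j"
          using l d by simp
        then have "(mul z ^^ (l + d * Suc q)) z = (mul z ^^ (l - i + d * q)) ((mul z ^^ j) z)"
          by (simp only: funpow_add comp_apply)
        also have "\<dots> = (mul z ^^ (l - i + d * q)) ((mul z ^^ i) z)"
          by (simp only: ij(2))
        also have "\<dots> = (mul z ^^ ((l - i + d * q) + i)) z"
          by (simp only: funpow_add comp_apply)
        also have "(l - i + d * q) + i = l + d * q" using l by simp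
        finally show ?case using Suc by simp
      qed simp
      \<comment> \<open>\<open>n + 1\<close> is a multiple of the period \<open>d\<close> and
        \<open>n \<ge> i\<close>, so \<open>z^(2n+2) = z^(n+1)\<close>. This power is idempotent,
        hence equal to \<open>e\<close>.\<close>
      define n where "n = d * Suc i - 1"
      have "Suc i \<le> d * Suc i" using d(1) by (cases d) simp_all
      then have n: "i \<le> n" "Suc n = d * Suc i" by (simp_all add: n_def)
      define w where "w = (mul z ^^ n) z"
      have w: "w \<in> ?Z" unfolding w_def by (rule pow_Z[OF z z])
      have "mul w w = (mul z ^^ n) (mul z w)"
        using pow_mul[OF z z w] by (simp add: w_def)
      also have "\<dots> = (mul z ^^ (n + Suc n)) z"
        unfolding w_def by (simp only: funpow_add comp_apply funpow.simps)
      also have "\<dots> = w" unfolding n(2) w_def by (rule period[OF n(1)])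
      finally show ?thesis using e_unique ZX[OF w] w_def by blast
    qed
    have "?Z \<noteq> {}" using False by (metis finite.emptyI)
    then have eZ: "e \<in> ?Z" using periodic pow_Z by (metis ex_in_conv)
    interpret Z: nonsingular_comm_sgrp ?Z mul
    proof
      show "finite A" if "A \<subseteq> ?Z" "\<And>a b. \<lbrakk>a \<in> A; b \<in> A\<rbrakk> \<Longrightarrow> mul a b = s" for A s
      proof (rule ccontr)
        assume "infinite A"
        then show False
          using that ZX central by (intro no_infinite_constant_square[of A s]) auto
      qed
      show "mul x y = mul y x" if "x \<in> ?Z" "y \<in> ?Z" for x y using that ZX central by simp
    qed (simp_all add: Z_closed mul_assoc ZX)
    let ?E = "mul e ` ?Z"
    have E: "x \<in> ?Z" "mul e x = x" if "x \<in> ?E" for x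
      using that eZ e ZX Z_closed by (auto simp: mul_assoc[symmetric])
    have "finite ?E"
    proof (rule ccontr)
      assume inf: "infinite ?E"
      have mul_E: "mul x y \<in> ?E" if "x \<in> ?E" "y \<in> ?E" for x y
      proof -
        have "mul x y = mul e (mul x y)" using E[OF that(1)] E(1)[OF that(2)] ZX eZ by (metis mul_assoc)
        then show ?thesis using Z_closed E(1) that by blast
      qed
      have eE: "e \<in> ?E" using eZ e(2) by (metis imageI)
      have pow_E: "(mul x ^^ n) x \<in> ?E" if "x \<in> ?E" for x n
        using that mul_E by (induction n) auto
      \<comment> \<open>A power \<open>x^(n+1) = e\<close> gives torsion, and for
        \<open>n > 0\<close> also the inverse \<open>x^n\<close>; for \<open>n = 0\<close> it says
        that \<open>x = e\<close>.\<close>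
      have "torsion_comm_group \<lparr>carrier = ?E, monoid.mult = mul, one = e\<rparr>" (is "torsion_comm_group ?G")
      proof -
        interpret comm_group ?G
        proof (rule comm_groupI, simp_all only: partial_object.simps monoid.simps)
          show "mul x y \<in> ?E" if "x \<in> ?E" "y \<in> ?E" for x y using mul_E that .
          show "e \<in> ?E" by (rule eE)
          show "mul (mul x y) z = mul x (mul y z)" if "x \<in> ?E" "y \<in> ?E" "z \<in> ?E" for x y z
            by (intro Z.assoc E(1) that)
          show "mul x y = mul y x" if "x \<in> ?E" "y \<in> ?E" for x y
            by (intro Z.comm E(1) that)
          show "mul e x = x" if "x \<in> ?E" for x using E(2)[OF that] .
          show "\<exists>y\<in>?E. mul y x = e" if x: "x \<in> ?E" for x
          proof -
            obtain n where n: "(mul x ^^ n) x = e" using periodic E(1)[OF x] by blast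
            show ?thesis
            proof (cases n)
              case 0
              then have "x = e" using n by simp
              then show ?thesis using e(2) eE by (intro bexI[of _ e]) simp_all
            next
              case (Suc k)
              then have "mul x ((mul x ^^ k) x) = e" using n by simp
              then have "mul ((mul x ^^ k) x) x = e"
                using Z.comm[OF E(1)[OF x] E(1)[OF pow_E[OF x, of k]]] by simp
              then show ?thesis using pow_E[OF x, of k] by (rule bexI)
            qed
          qed
        qed
        have pow: "x [^]\<^bsub>?G\<^esub> Suc n = (mul x ^^ n) x" if x: "x \<in> ?E" for x n
        proof (induction n)
          case 0
          have "x [^]\<^bsub>?G\<^esub> Suc 0 = mul e x" by (simp only: nat_pow_Suc nat_pow_0 monoid.simps)
          then show ?case using E(2)[OF x] by (simp only: funpow_0)
        next
          case (Suc n)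
          have "x [^]\<^bsub>?G\<^esub> Suc (Suc n) = mul ((mul x ^^ n) x) x"
            by (simp only: nat_pow_Suc[of _ "Suc n"] Suc monoid.simps)
          also have "\<dots> = mul x ((mul x ^^ n) x)"
            by (rule Z.comm[OF E(1)[OF pow_E[OF x]] E(1)[OF x]])
          finally show ?case by (simp only: funpow.simps comp_apply)
        qed
        show ?thesis
        proof
          fix x assume "x \<in> carrier ?G"
          then have x: "x \<in> ?E" by (simp only: partial_object.simps)
          then obtain n where "(mul x ^^ n) x = e" using periodic[OF E(1)] by blast
          then have "x [^]\<^bsub>?G\<^esub> Suc n = \<one>\<^bsub>?G\<^esub>"
            by (simp only: pow[OF x] monoid.simps)
          then show "\<exists>n>0. x [^]\<^bsub>?G\<^esub> (n::nat) = \<one>\<^bsub>?G\<^esub>"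
            by blast
        qed
      qed
      then show False
      proof (rule no_infinite_central_group)
        show "?E \<subseteq> X" using E(1) ZX by blast
        show "mul x a = mul a x" if "a \<in> ?E" "x \<in> X" for a x using central E(1) that by blast
      qed (rule inf)
    qed
    interpret Z: finite_kernel_sgrp ?Z mul e
      by unfold_locales (use eZ e \<open>finite ?E\<close> in auto)
    have "\<exists>n. \<forall>z\<in>?Z. (mul z ^^ n) z \<in> ?E"
    proof (rule Z.bounded)
      show "\<exists>n. (mul z ^^ n) z \<in> ?E" if "z \<in> ?Z" for z
        using periodic[OF that] eZ e(2) by (metis imageI)
    qed
    then show ?thesis
      by (rule Z.closedin_image[OF S h])
  qed
qed

end
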